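(* Let $K=\mathbb{F}_{p^s}$ be a finite field different from $\mathbb{F}_2$. Then: (1) $\beta_p(\mathcal{M}_K(m))\ge m$, for all $m\ge 1$. (2) If $K\ne\mathbb{F}_3$, the matroids $\mathcal{M}_K(m)$ are non-realizable over $\mathbb{C}$, for all $m\ge 2$.
   Context: For a finite field $K$ and $m\ge 1$, $\mathcal{M}_K(m)$ is the simple matroid of rank at most $3$ on the ground set $K^m$ whose dependent subsets of size $3$ are the triples of collinear points (with respect to affine lines in $K^m$). It has rank $2$ for $m=1$, and for $m\ge 2$ it is the rank-$3$ truncation of the affine geometry $\mathrm{AG}(m,K)$. For a simple matroid $\mathcal{M}$, the Orlik–Solomon algebra is $A(\mathcal{M})=E/(\partial e_S : S\text{ a circuit})$, with $E$ the exterior algebra over $\mathbb{Z}$ on degree-one generators $e_u$, $u\in\mathcal{M}$, $\partial$ the graded derivation of degree $-1$ with $\partial e_u=1$, $e_S=\prod_{u\in S}e_u$. With $\sigma=\sum_u e_u$, $\beta_p(\mathcal{M})=\dim_{\mathbb{F}_p}\{\tau\in A^1(\mathcal{M})\otimes\mathbb{F}_p\mid\sigma\tau=0\text{ in }A^2(\mathcal{M})\otimes\mathbb{F}_p\}-1$ (unchanged if $\mathbb{F}_p$ is replaced by any field of characteristic $p$ and dimension is taken over that field). A simple matroid $\mathcal{M}$ is realizable over $\mathbb{C}$ if there is a central hyperplane arrangement $\mathcal{A}$ in some $\mathbb{C}^\ell$ with $L(\mathcal{M})\cong L(\mathcal{A})$, where $L(\mathcal{M})$ is the lattice of flats and $L(\mathcal{A})$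 the intersection lattice ordered by reverse inclusion. *)

theory Defs
  imports
    "HOL-Library.Poly_Mapping"
    "HOL-Library.Cardinality"
    "HOL-Algebra.Embedded_Algebras"
    "HOL-Computational_Algebra.Primes"
    "Jordan_Normal_Form.Matrix"
begin

section \<open>Matroids\<close>

record 'a matroid =
  ground :: "'a set"
  indep :: "'a set \<Rightarrow> bool"

definition matroid :: "'a matroid \<Rightarrow> bool" where
  "matroid M \<longleftrightarrow> finite (ground M) \<and> indep M {} \<and>
    (\<forall>X. indep M X \<longrightarrow> X \<subseteq> ground M) \<and>
    (\<forall>X Y. indep M Y \<and> X \<subseteq> Y \<longrightarrow> indep M X) \<and>
    (\<forall>X Y. indep M X \<and> indep M Y \<and> card X < card Y \<longrightarrow> (\<exists>y \<in> Y - X. indep M (insert y X)))"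

definition simple_matroid :: "'a matroid \<Rightarrow> bool" where
  "simple_matroid M \<longleftrightarrow> matroid M \<and> (\<forall>X \<subseteq> ground M. card X \<le> 2 \<longrightarrow> indep M X)"

definition circuit :: "'a matroid \<Rightarrow> 'a set \<Rightarrow> bool" where
  "circuit M C \<longleftrightarrow> C \<subseteq> ground M \<and> \<not> indep M C \<and> (\<forall>X. X \<subset> C \<longrightarrow> indep M X)"

definition matroid_rank :: "'a matroid \<Rightarrow> 'a set \<Rightarrow> nat" where
  "matroid_rank M X = Max (card ` {I. I \<subseteq> X \<and> indep M I})"

definition flats :: "'a matroid \<Rightarrow> 'a set set" where
  "flats M = {F. F \<subseteq> ground M \<and>
    (\<forall>x \<in> ground M - F. matroid_rank M F < matroid_rank M (insert x F))}"


section \<open>The matroids \<open>\<M>\<^sub>K(m)\<close>\<close>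

definition affine_line :: "nat \<Rightarrow> 'k::field vec set \<Rightarrow> bool" where
  "affine_line m L \<longleftrightarrow> (\<exists>a \<in> carrier_vec m. \<exists>v \<in> carrier_vec m. v \<noteq> 0\<^sub>v m \<and> L = {a + t \<cdot>\<^sub>v v | t. True})"

definition collinear_in :: "nat \<Rightarrow> 'k::field vec set \<Rightarrow> bool" where
  "collinear_in m X \<longleftrightarrow> (\<exists>L. affine_line m L \<and> X \<subseteq> L)"

definition affine_matroid :: "nat \<Rightarrow> 'k::{field,finite} vec matroid" where
  "affine_matroid m = \<lparr>ground = carrier_vec m,
     indep = (\<lambda>X. X \<subseteq> carrier_vec m \<and> card X \<le> 3 \<and> (card X = 3 \<longrightarrow> \<not> collinear_in m X))\<rparr>"

lemma finite_carrier_vec: "finite (carrier_vec m :: 'k::finite vec set)"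
proof -
  have "carrier_vec m \<subseteq> vec m ` ({..<m} \<rightarrow>\<^sub>E (UNIV :: 'k set))"
  proof
    fix v :: "'k vec" assume "v \<in> carrier_vec m"
    then have "v = vec m (restrict (\<lambda>i. v $ i) {..<m})" by auto
    then show "v \<in> vec m ` ({..<m} \<rightarrow>\<^sub>E UNIV)" by auto
  qed
  then show ?thesis by (rule finite_subset) (auto intro!: finite_PiE)
qed

lemma affine_line_unique:
  fixes L L' :: "'k::field vec set"
  assumes "affine_line m L" "affine_line m L'" "x \<noteq> y" "x \<in> L" "y \<in> L" "x \<in> L'" "y \<in> L'"
  shows "L = L'"
proof -
  have char: "L = {x + t \<cdot>\<^sub>v (y - x) | t. True}"
    if "affine_line m L" "x \<in> L" "y \<in> L" for L
  proof -
    from that obtain a v r s where a: "a \<in> carrier_vec m" and v: "v \<in> carrier_vec m"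
      and L: "L = {a + t \<cdot>\<^sub>v v | t. True}" and x: "x = a + r \<cdot>\<^sub>v v" and y: "y = a + s \<cdot>\<^sub>v v"
      unfolding affine_line_def by blast
    have rs: "s - r \<noteq> 0" using \<open>x \<noteq> y\<close> x y by auto
    have 1: "a + t \<cdot>\<^sub>v v = x + ((t - r) / (s - r)) \<cdot>\<^sub>v (y - x)" for t
    proof (intro eq_vecI)
      fix i assume "i < dim_vec (x + ((t - r) / (s - r)) \<cdot>\<^sub>v (y - x))"
      then have i: "i < m" using x y a v by auto
      have "((t - r) / (s - r)) * (a $ i + s * v $ i - (a $ i + r * v $ i)) = (t - r) * v $ i"
        using rs by (simp add: left_diff_distrib[symmetric])
      then show "(a + t \<cdot>\<^sub>v v) $ i = (x + ((t - r) / (s - r)) \<cdot>\<^sub>v (y - x)) $ i"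
        using i a v x y by (simp add: algebra_simps)
    qed (use a v x y in auto)
    have 2: "x + t \<cdot>\<^sub>v (y - x) = a + (r + t * (s - r)) \<cdot>\<^sub>v v" for t
      by (intro eq_vecI) (use a v x y in \<open>auto simp: algebra_simps\<close>)
    show ?thesis unfolding L using 1 2 by blast
  qed
  show ?thesis using char[of L] char[of L'] assms by simp
qed

lemma collinear_pair:
  assumes "x \<in> carrier_vec m" "y \<in> carrier_vec m" "x \<noteq> (y :: 'k::field vec)"
  shows "collinear_in m {x, y}"
proof -
  have nz: "y - x \<noteq> 0\<^sub>v m"
  proof
    assume "y - x = 0\<^sub>v m"
    then have "(y - x) $ i = 0" if "i < m" for i using that by simp
    then have "x = y" using assms by (intro eq_vecI) auto
    then show False using assms by simp
  qed
  have "x = x + 0 \<cdot>\<^sub>v (y - x)" "y = x + 1 \<cdot>\<^sub>v (y - x)"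
    using assms by (auto intro!: eq_vecI)
  then have "{x, y} \<subseteq> {x + t \<cdot>\<^sub>v (y - x) | t. True}" by blast
  moreover have "affine_line m {x + t \<cdot>\<^sub>v (y - x) | t. True}"
    unfolding affine_line_def using assms nz by (intro bexI[of _ x] bexI[of _ "y - x"]) auto
  ultimately show ?thesis unfolding collinear_in_def by blast
qed

lemma simple_affine_matroid: "simple_matroid (affine_matroid m :: 'k::{field,finite} vec matroid)"
proof -
  let ?M = "affine_matroid m :: 'k vec matroid"
  have fin: "finite X" if "X \<subseteq> carrier_vec m" for X :: "'k vec set"
    using that finite_carrier_vec finite_subset by blast
  have down: "indep ?M X" if "indep ?M Y" "X \<subseteq> Y" for X Y
  proof -
    from that have Y: "Y \<subseteq> carrier_vec m" "card Y \<le> 3" "card Y = 3 \<longrightarrow> \<not> collinear_in m Y"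
      by (auto simp: affine_matroid_def)
    have "card X \<le> card Y" using fin[OF Y(1)] that(2) by (rule card_mono)
    moreover have "X = Y" if "card X = 3"
      using that Y(2) \<open>X \<subseteq> Y\<close> \<open>card X \<le> card Y\<close> fin[OF Y(1)] by (simp add: card_subset_eq)
    ultimately show ?thesis using Y that(2) by (auto simp: affine_matroid_def)
  qed
  have aug: "\<exists>y \<in> Y - X. indep ?M (insert y X)"
    if XY: "indep ?M X" "indep ?M Y" "card X < card Y" for X Y
  proof -
    from XY have X: "X \<subseteq> carrier_vec m" and Y: "Y \<subseteq> carrier_vec m" "card Y \<le> 3"
        "card Y = 3 \<longrightarrow> \<not> collinear_in m Y"
      by (auto simp: affine_matroid_def)
    have "\<not> Y \<subseteq> X" using XY(3) card_mono[OF fin[OF X]] by (meson not_le)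
    then obtain y0 where y0: "y0 \<in> Y - X" by blast
    show ?thesis
    proof (cases "card X < 2")
      case True
      then have "indep ?M (insert y0 X)"
        using X Y(1) y0 by (auto simp: affine_matroid_def card_insert_if fin[OF X])
      then show ?thesis using y0 by blast
    next
      case False
      then have c: "card X = 2" "card Y = 3" using XY(3) Y(2) by auto
      then obtain a b where ab: "X = {a, b}" "a \<noteq> b" by (meson card_2_iff)
      obtain L where L: "affine_line m L" "X \<subseteq> L"
        using collinear_pair[of a m b] X ab unfolding collinear_in_def by auto
      obtain y where y: "y \<in> Y" "y \<notin> L"
        using Y(3) c(2) L(1) unfolding collinear_in_def by blast
      have "\<not> collinear_in m (insert y X)"
      proof
        assume "collinear_in m (insert y X)"
        then obtain L' where L': "affine_line m L'" "insert y X \<subseteq> L'"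
          unfolding collinear_in_def by blast
        have "L = L'" using affine_line_unique[OF L(1) L'(1) ab(2)] L(2) L'(2) ab(1) by blast
        then show False using y L' by blast
      qed
      moreover have "y \<notin> X" using y L by blast
      ultimately show ?thesis
        using X Y(1) y(1) c(1)
        by (intro bexI[of _ y]) (auto simp: affine_matroid_def card_insert_if fin[OF X])
    qed
  qed
  have "finite (ground ?M)" "indep ?M {}"
    by (simp_all add: affine_matroid_def finite_carrier_vec)
  moreover have "X \<subseteq> ground ?M" if "indep ?M X" for X
    using that by (simp add: affine_matroid_def)
  ultimately have "matroid ?M" unfolding matroid_def using down aug by metis
  then show ?thesis unfolding simple_matroid_def by (auto simp: affine_matroid_def)
qed


section \<open>The Orlik--Solomon algebra\<close>

datatype 'a free_monoid = Letters "'a list"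

instantiation free_monoid :: (type) monoid_add
begin
definition "0 = Letters []"
fun plus_free_monoid :: "'a free_monoid \<Rightarrow> 'a free_monoid \<Rightarrow> 'a free_monoid" where
  "Letters us + Letters vs = Letters (us @ vs)"
instance
proof
  fix a b c :: "'a free_monoid"
  show "a + b + c = a + (b + c)" by (cases a; cases b; cases c) simp
  show "0 + a = a" "a + 0 = a" by (cases a, simp add: zero_free_monoid_def)+
qed
end

text \<open>The type \<open>'a free_monoid \<Rightarrow>\<^sub>0 int\<close>, with the convolution product provided by the
  library, is the free associative ring (tensor algebra) over \<open>\<int>\<close> on generators indexed by \<open>'a\<close>.\<close>

definition word :: "'a list \<Rightarrow> 'a free_monoid \<Rightarrow>\<^sub>0 int" where
  "word us = Poly_Mapping.single (Letters us) 1"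

definition tensor_degree :: "'a set \<Rightarrow> nat \<Rightarrow> ('a free_monoid \<Rightarrow>\<^sub>0 int) set" where
  "tensor_degree V d = {f. Poly_Mapping.keys f \<subseteq> {Letters us | us. set us \<subseteq> V \<and> length us = d}}"

definition tensor_algebra :: "'a set \<Rightarrow> ('a free_monoid \<Rightarrow>\<^sub>0 int) ring" where
  "tensor_algebra V = \<lparr>carrier = {f. Poly_Mapping.keys f \<subseteq> {Letters us | us. set us \<subseteq> V}},
     monoid.mult = (*), one = 1, zero = 0, add = (+)\<rparr>"

definition exterior_ideal :: "'a set \<Rightarrow> ('a free_monoid \<Rightarrow>\<^sub>0 int) set" where
  "exterior_ideal V = genideal (tensor_algebra V) {x * x | x. x \<in> tensor_degree V 1}"

definition exterior_algebra :: "'a set \<Rightarrow> ('a free_monoid \<Rightarrow>\<^sub>0 int) set ring" where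
  "exterior_algebra V = tensor_algebra V Quot exterior_ideal V"

definition exterior_class :: "'a set \<Rightarrow> ('a free_monoid \<Rightarrow>\<^sub>0 int) \<Rightarrow> ('a free_monoid \<Rightarrow>\<^sub>0 int) set" where
  "exterior_class V x = exterior_ideal V +>\<^bsub>tensor_algebra V\<^esub> x"

text \<open>The graded derivation \<open>\<partial>\<close> of degree \<open>-1\<close> with \<open>\<partial> e\<^sub>u = 1\<close>, evaluated on the monomial
  \<open>e\<^sub>u\<^sub>1 \<cdots> e\<^sub>u\<^sub>k\<close>: the recursion is \<open>\<partial>(e\<^sub>u x) = (\<partial> e\<^sub>u) x - e\<^sub>u (\<partial> x)\<close>.\<close>

fun boundary :: "'a list \<Rightarrow> 'a free_monoid \<Rightarrow>\<^sub>0 int" where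
  "boundary [] = 0"
| "boundary (u # us) = word us - word [u] * boundary us"

lemma boundary_append:
  "boundary (us @ vs) = boundary us * word vs + (-1) ^ length us * (word us * boundary vs)"
proof (induction us)
  case Nil
  have "word [] = (1 :: 'a free_monoid \<Rightarrow>\<^sub>0 int)"
    by (simp add: word_def flip: zero_free_monoid_def)
  then show ?case by simp
next
  case (Cons u us)
  have w: "word (xs @ ys) = word xs * word ys" for xs ys :: "'a list"
    by (simp add: word_def mult_single)
  have u: "word (u # us) = word [u] * word us" using w[of "[u]" us] by simp
  have "word [u] * ((-1) ^ k * x) = (-1) ^ k * (word [u] * x)" for k and x :: "'a free_monoid \<Rightarrow>\<^sub>0 int"
    by (cases "even k") simp_all
  then show ?case by (simp add: Cons u w algebra_simps)
qed

text \<open>The monomial \<open>e\<^sub>S\<close> depends on the chosen order of \<open>S\<close> up to sign only, so taking all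
  enumerations \<open>us\<close> of a circuit yields the same ideal as taking one.\<close>

definition os_ideal :: "'a matroid \<Rightarrow> ('a free_monoid \<Rightarrow>\<^sub>0 int) set set" where
  "os_ideal M = genideal (exterior_algebra (ground M))
     {exterior_class (ground M) (boundary us) | us. distinct us \<and> circuit M (set us)}"

definition orlik_solomon :: "'a matroid \<Rightarrow> ('a free_monoid \<Rightarrow>\<^sub>0 int) set set ring" where
  "orlik_solomon M = exterior_algebra (ground M) Quot os_ideal M"

definition os_class :: "'a matroid \<Rightarrow> ('a free_monoid \<Rightarrow>\<^sub>0 int) \<Rightarrow> ('a free_monoid \<Rightarrow>\<^sub>0 int) set set" where
  "os_class M x = os_ideal M +>\<^bsub>exterior_algebra (ground M)\<^esub> exterior_class (ground M) x"

text \<open>\<open>A(M) \<otimes> \<int>/p\<close>, realised as \<open>A(M) / p A(M)\<close>.\<close>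

definition mod_ideal :: "nat \<Rightarrow> 'a matroid \<Rightarrow> ('a free_monoid \<Rightarrow>\<^sub>0 int) set set set" where
  "mod_ideal p M = genideal (orlik_solomon M) {[p] \<cdot>\<^bsub>orlik_solomon M\<^esub> \<one>\<^bsub>orlik_solomon M\<^esub>}"

definition orlik_solomon_mod :: "nat \<Rightarrow> 'a matroid \<Rightarrow> ('a free_monoid \<Rightarrow>\<^sub>0 int) set set set ring" where
  "orlik_solomon_mod p M = orlik_solomon M Quot mod_ideal p M"

definition os_mod_class ::
    "nat \<Rightarrow> 'a matroid \<Rightarrow> ('a free_monoid \<Rightarrow>\<^sub>0 int) \<Rightarrow> ('a free_monoid \<Rightarrow>\<^sub>0 int) set set set" where
  "os_mod_class p M x = mod_ideal p M +>\<^bsub>orlik_solomon M\<^esub> os_class M x"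

text \<open>The image of \<open>\<int>\<close> in \<open>A(M) \<otimes> \<int>/p\<close>; a copy of the field \<open>\<F>\<^sub>p\<close> when \<open>p\<close> is prime.\<close>

definition os_mod_scalars :: "nat \<Rightarrow> 'a matroid \<Rightarrow> ('a free_monoid \<Rightarrow>\<^sub>0 int) set set set set" where
  "os_mod_scalars p M =
     {[n] \<cdot>\<^bsub>orlik_solomon_mod p M\<^esub> \<one>\<^bsub>orlik_solomon_mod p M\<^esub> | n :: int. True}"

definition os_mod_degree :: "nat \<Rightarrow> 'a matroid \<Rightarrow> nat \<Rightarrow> ('a free_monoid \<Rightarrow>\<^sub>0 int) set set set set" where
  "os_mod_degree p M d = os_mod_class p M ` tensor_degree (ground M) d"

definition os_mod_sigma :: "nat \<Rightarrow> 'a matroid \<Rightarrow> ('a free_monoid \<Rightarrow>\<^sub>0 int) set set set" where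
  "os_mod_sigma p M = os_mod_class p M (\<Sum>u \<in> ground M. word [u])"

definition aomoto_betti :: "nat \<Rightarrow> 'a matroid \<Rightarrow> int" where
  "aomoto_betti p M = int (ring.dim (orlik_solomon_mod p M) (os_mod_scalars p M)
     {\<tau> \<in> os_mod_degree p M 1.
        os_mod_sigma p M \<otimes>\<^bsub>orlik_solomon_mod p M\<^esub> \<tau> = \<zero>\<^bsub>orlik_solomon_mod p M\<^esub>}) - 1"

lemma ring_tensor_algebra: "ring (tensor_algebra V)"
proof -
  define W where "W = {Letters us | us. set us \<subseteq> V}"
  have W: "a + b \<in> W" if "a \<in> W" "b \<in> W" for a b
  proof -
    from that obtain us vs where "a = Letters us" "b = Letters vs" "set us \<subseteq> V" "set vs \<subseteq> V"
      unfolding W_def by blast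
    then show ?thesis unfolding W_def by (intro CollectI exI[of _ "us @ vs"]) simp
  qed
  have mul: "Poly_Mapping.keys (f * g) \<subseteq> W"
    if "Poly_Mapping.keys f \<subseteq> W" "Poly_Mapping.keys g \<subseteq> W"
    for f g :: "'a free_monoid \<Rightarrow>\<^sub>0 int"
  proof
    fix k assume "k \<in> Poly_Mapping.keys (f * g)"
    then have "k \<in> {a + b | a b. a \<in> Poly_Mapping.keys f \<and> b \<in> Poly_Mapping.keys g}"
      by (rule subsetD[OF keys_mult])
    then obtain a b where "k = a + b" "a \<in> Poly_Mapping.keys f" "b \<in> Poly_Mapping.keys g"
      by auto
    then show "k \<in> W" using W[of a b] that by (simp add: subsetD)
  qed
  have pls: "Poly_Mapping.keys (f + g) \<subseteq> W"
    if "Poly_Mapping.keys f \<subseteq> W" "Poly_Mapping.keys g \<subseteq> W"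
    for f g :: "'a free_monoid \<Rightarrow>\<^sub>0 int"
    by (rule order_trans[OF Poly_Mapping.keys_add]) (simp add: that)
  have "Letters [] \<in> W" unfolding W_def by (intro CollectI exI[of _ "[]"]) simp
  then have one: "Poly_Mapping.keys (1 :: 'a free_monoid \<Rightarrow>\<^sub>0 int) \<subseteq> W"
    by (simp add: zero_free_monoid_def)
  have neg: "\<exists>g. Poly_Mapping.keys g \<subseteq> W \<and> g + f = 0"
    if "Poly_Mapping.keys f \<subseteq> W" for f :: "'a free_monoid \<Rightarrow>\<^sub>0 int"
    by (rule exI[of _ "- f"]) (simp add: that)
  let ?R = "\<lparr>carrier = {f :: 'a free_monoid \<Rightarrow>\<^sub>0 int. Poly_Mapping.keys f \<subseteq> W},
     monoid.mult = (*), one = 1, zero = 0, add = (+)\<rparr>"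
  have "abelian_group ?R"
    by (rule abelian_groupI) (use pls neg in \<open>auto simp: add.assoc add.commute\<close>)
  moreover have "Group.monoid ?R"
    by (rule monoidI) (use mul one in \<open>auto simp: mult.assoc\<close>)
  ultimately have "ring ?R"
    by (rule ringI) (simp_all add: distrib_left distrib_right)
  then show ?thesis unfolding tensor_algebra_def W_def .
qed

lemma exterior_ideal: "ideal (exterior_ideal V) (tensor_algebra V)"
proof -
  interpret ring "tensor_algebra V" by (rule ring_tensor_algebra)
  have "y * y \<in> carrier (tensor_algebra V)" if "y \<in> tensor_degree V 1" for y
  proof -
    have "y \<in> carrier (tensor_algebra V)"
      using that unfolding tensor_algebra_def tensor_degree_def by fastforce
    then have "y \<otimes>\<^bsub>tensor_algebra V\<^esub> y \<in> carrier (tensor_algebra V)" by blast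
    then show ?thesis by (simp add: tensor_algebra_def)
  qed
  then show ?thesis unfolding exterior_ideal_def by (intro genideal_ideal) blast
qed

lemma ring_exterior_algebra: "ring (exterior_algebra V)"
  unfolding exterior_algebra_def by (rule ideal.quotient_is_ring[OF exterior_ideal])

lemma word_closed: "set us \<subseteq> V \<Longrightarrow> word us \<in> carrier (tensor_algebra V)"
  by (auto simp: word_def tensor_algebra_def)

lemma boundary_closed: "set us \<subseteq> V \<Longrightarrow> boundary us \<in> carrier (tensor_algebra V)"
proof (induction us)
  case Nil
  then show ?case by (simp add: tensor_algebra_def)
next
  case (Cons u us)
  interpret ring "tensor_algebra V" by (rule ring_tensor_algebra)
  have "word [u] \<otimes>\<^bsub>tensor_algebra V\<^esub> boundary us \<in> carrier (tensor_algebra V)"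
    using Cons word_closed[of "[u]" V] by (intro m_closed) simp_all
  then have "Poly_Mapping.keys (word [u] * boundary us) \<subseteq> {Letters us | us. set us \<subseteq> V}"
    by (simp add: tensor_algebra_def)
  moreover have "Poly_Mapping.keys (word us) \<subseteq> {Letters us | us. set us \<subseteq> V}"
    using word_closed[of us V] Cons.prems by (simp add: tensor_algebra_def)
  ultimately have "Poly_Mapping.keys (word us - word [u] * boundary us)
      \<subseteq> {Letters us | us. set us \<subseteq> V}"
    by (intro order_trans[OF keys_diff] Un_least)
  then show ?case by (simp add: tensor_algebra_def)
qed

lemma os_ideal: "ideal (os_ideal M) (exterior_algebra (ground M))"
proof -
  interpret E: ring "exterior_algebra (ground M)" by (rule ring_exterior_algebra)
  interpret I: ideal "exterior_ideal (ground M)" "tensor_algebra (ground M)"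
    by (rule exterior_ideal)
  have "exterior_class (ground M) (boundary us) \<in> carrier (exterior_algebra (ground M))"
    if "circuit M (set us)" for us
    unfolding exterior_class_def exterior_algebra_def
    by (rule ring_hom_closed[OF I.rcos_ring_hom], rule boundary_closed)
       (use that in \<open>simp add: circuit_def\<close>)
  then show ?thesis unfolding os_ideal_def by (intro E.genideal_ideal) blast
qed

lemma ring_orlik_solomon: "ring (orlik_solomon M)"
  unfolding orlik_solomon_def by (rule ideal.quotient_is_ring[OF os_ideal])

lemma ring_orlik_solomon_mod: "ring (orlik_solomon_mod p M)"
proof -
  interpret ring "orlik_solomon M" by (rule ring_orlik_solomon)
  have "ideal (mod_ideal p M) (orlik_solomon M)"
    unfolding mod_ideal_def by (intro genideal_ideal) simp
  then show ?thesis unfolding orlik_solomon_mod_def by (rule ideal.quotient_is_ring)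
qed


section \<open>Realizability over the complex numbers\<close>

definition linear_hyperplane :: "nat \<Rightarrow> complex vec set \<Rightarrow> bool" where
  "linear_hyperplane l H \<longleftrightarrow>
     (\<exists>a \<in> carrier_vec l. a \<noteq> 0\<^sub>v l \<and> H = {x \<in> carrier_vec l. a \<bullet> x = 0})"

definition central_arrangement :: "nat \<Rightarrow> complex vec set set \<Rightarrow> bool" where
  "central_arrangement l \<A> \<longleftrightarrow> finite \<A> \<and> (\<forall>H \<in> \<A>. linear_hyperplane l H)"

text \<open>The empty intersection is the ambient space.\<close>

definition intersection_lattice :: "nat \<Rightarrow> complex vec set set \<Rightarrow> complex vec set set" where
  "intersection_lattice l \<A> = {carrier_vec l \<inter> \<Inter>\<B> | \<B>. \<B> \<subseteq> \<A>}"

definition realizable_over_complex :: "'a matroid \<Rightarrow> bool" where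
  "realizable_over_complex M \<longleftrightarrow> (\<exists>l \<A> f. central_arrangement l \<A> \<and>
     bij_betw f (flats M) (intersection_lattice l \<A>) \<and>
     (\<forall>X \<in> flats M. \<forall>Y \<in> flats M. X \<subseteq> Y \<longleftrightarrow> f Y \<subseteq> f X))"

end

theory Submission
  imports Defs
begin

text \<open>
  Non-realizability: a realization by hyperplanes restricts to a map from \<open>K\<^sup>2\<close> to
  \<open>\<P>\<^sup>2(\<complex>)\<close> which preserves and reflects collinearity. For \<open>|K| \<ge> 4\<close>, Desargues' theorem,
  applied to triangles in perspective from an axis inside the affine plane, shows that the lines
  of a parallel class become concurrent. Moving the centres of the vertical and of the horizontal
  class to infinity, the map becomes \<open>(x, y) \<mapsto> (f x, f y)\<close> with \<open>f : K \<rightarrow> \<complex>\<close> injective and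
  multiplicative, and \<open>f (1 + x) = 1 + c f x\<close> for a constant \<open>c\<close>. If \<open>K\<close> has odd
  characteristic then \<open>c = 1\<close> and \<open>f\<close> is additive, which is absurd; in characteristic 2 one gets
  \<open>c = -1\<close>, and computing \<open>f (1 + x) = f x f (1 + 1 / x)\<close> gives \<open>f x = 1\<close> for all
  \<open>x \<noteq> 0, 1\<close>.

  Lower bound: on a line with base point \<open>b\<close> the circuit relations give
  \<open>e\<^sub>u e\<^sub>v = e\<^sub>b e\<^sub>v - e\<^sub>b e\<^sub>u\<close>, so every \<open>\<tau> = \<Sum> \<eta>\<^sub>u e\<^sub>u\<close> with \<open>\<eta>\<close> summing to 0
  modulo \<open>p\<close> over each line satisfies \<open>\<sigma> \<tau> = 0\<close>. Such \<open>\<eta>\<close> are the constant 1 and the functions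
  \<open>u \<mapsto> g (u\<^sub>i)\<close>, where \<open>g\<close> is \<open>1\<close> at \<open>0\<close>, \<open>-1\<close> at \<open>1\<close> and \<open>0\<close> elsewhere: a coordinate is
  either constant or bijective on a line. They are independent because \<open>|K| > 2\<close>.
\<close>

section \<open>Projective geometry in homogeneous coordinates\<close>

type_synonym 'a triple = "'a \<times> 'a \<times> 'a"

fun dot :: "'a::comm_ring triple \<Rightarrow> 'a triple \<Rightarrow> 'a" where
  "dot (a1, a2, a3) (b1, b2, b3) = a1 * b1 + a2 * b2 + a3 * b3"

fun cross :: "'a::comm_ring triple \<Rightarrow> 'a triple \<Rightarrow> 'a triple" where
  "cross (a1, a2, a3) (b1, b2, b3) = (a2 * b3 - a3 * b2, a3 * b1 - a1 * b3, a1 * b2 - a2 * b1)"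

text \<open>Homogeneous coordinates matter only up to a factor; the multiple of \<open>a\<close> by
  \<open>k\<close> is written \<open>comb k a 0 a\<close> throughout.\<close>

fun comb :: "'a::comm_ring \<Rightarrow> 'a triple \<Rightarrow> 'a \<Rightarrow> 'a triple \<Rightarrow> 'a triple" where
  "comb r (a1, a2, a3) s (b1, b2, b3) = (r * a1 + s * b1, r * a2 + s * b2, r * a3 + s * b3)"

definition det3 :: "'a::comm_ring triple \<Rightarrow> 'a triple \<Rightarrow> 'a triple \<Rightarrow> 'a" where
  "det3 a b c = dot (cross a b) c"

lemma det3_comb_left: "det3 (comb r a s b) c d = r * det3 a c d + s * det3 b c d"
  by (cases a; cases b; cases c; cases d) (simp add: det3_def algebra_simps)

lemma det3_cyclic: "det3 b c a = det3 a b c"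
  by (cases a; cases b; cases c) (simp add: det3_def algebra_simps)

lemma det3_swap: "det3 b a c = - det3 a b c"
  by (cases a; cases b; cases c) (simp add: det3_def algebra_simps)

lemma det3_same [simp]: "det3 a a b = 0" "det3 a b a = 0" "det3 b a a = 0"
  by (cases a; cases b; simp add: det3_def algebra_simps)+

text \<open>In the basis \<open>a\<close>, \<open>b\<close>, \<open>c\<close> the coefficient of
  \<open>c\<close> is proportional to \<open>det3 a b d\<close>, hence zero. The point
  \<open>c\<close> only certifies that \<open>a\<close> and \<open>b\<close> are
  independent.\<close>

lemma cramer:
  fixes a b c d :: "'a::field triple"
  assumes "det3 a b d = 0" "det3 a b c \<noteq> 0"
  obtains r s where "d = comb r a s b"
proof -
  obtain a1 a2 a3 where a: "a = (a1, a2, a3)" by (cases a)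
  obtain b1 b2 b3 where b: "b = (b1, b2, b3)" by (cases b)
  obtain c1 c2 c3 where c: "c = (c1, c2, c3)" by (cases c)
  obtain d1 d2 d3 where d: "d = (d1, d2, d3)" by (cases d)
  let ?D = "det3 a b c" and ?r = "det3 d b c" and ?s = "det3 a d c"
  have e: "?D * d1 = ?r * a1 + ?s * b1 + det3 a b d * c1"
     "?D * d2 = ?r * a2 + ?s * b2 + det3 a b d * c2"
     "?D * d3 = ?r * a3 + ?s * b3 + det3 a b d * c3"
    unfolding a b c d det3_def by (simp_all add: algebra_simps)
  have "d = comb (?r / ?D) a (?s / ?D) b"
    using e assms by (simp add: a b d field_simps)
  then show ?thesis by (rule that)
qed

text \<open>Taking cross products as line coordinates, the choice of two points on a line matters
  only up to a factor.\<close>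

lemma cross_comb: "cross (comb r a s b) (comb r' a s' b) = comb (r * s' - s * r') (cross a b) 0 (cross a b)"
  by (cases a; cases b) (simp add: algebra_simps)

lemma cross_dot [simp]: "dot (cross a b) a = 0" "dot (cross a b) b = 0" 
  by (cases a; cases b; simp add: algebra_simps)+

lemma dot_comm: "dot a b = dot b a"
  by (cases a; cases b) (simp add: algebra_simps)

section \<open>Change of basis and Desargues' theorem\<close>

fun comb3 :: "'a::comm_ring triple \<Rightarrow> 'a triple \<Rightarrow> 'a triple \<Rightarrow> 'a triple \<Rightarrow> 'a triple" where
  "comb3 (r, s, t) (a1, a2, a3) (b1, b2, b3) (c1, c2, c3) =
     (r * a1 + s * b1 + t * c1, r * a2 + s * b2 + t * c2, r * a3 + s * b3 + t * c3)"

lemma det3_comb3: "det3 (comb3 u a b c) (comb3 v a b c) (comb3 w a b c) = det3 u v w * det3 a b c"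
  by (cases a; cases b; cases c; cases u; cases v; cases w) (simp add: det3_def algebra_simps)

text \<open>\<open>comb3\<close> applies the matrix with columns \<open>a\<close>, \<open>b\<close>,
  \<open>c\<close> to a vector; cross products, that is lines, then transform by its cofactor
  matrix.\<close>

lemma cross_comb3:
  "cross (comb3 u a b c) (comb3 v a b c) = comb3 (cross u v) (cross b c) (cross c a) (cross a b)"
  by (cases a; cases b; cases c; cases u; cases v) (simp add: algebra_simps)

lemma det3_cross: "det3 (cross b c) (cross c a) (cross a b) = det3 a b c * det3 a b c"
  by (cases a; cases b; cases c) (simp add: det3_def algebra_simps)

lemma comb3_coordinates:
  fixes a b c :: "'a::field triple"
  assumes "det3 a b c \<noteq> 0"
  shows "\<exists>u. d = comb3 u a b c"
proof -
  obtain a1 a2 a3 where a: "a = (a1, a2, a3)" by (cases a)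
  obtain b1 b2 b3 where b: "b = (b1, b2, b3)" by (cases b)
  obtain c1 c2 c3 where c: "c = (c1, c2, c3)" by (cases c)
  obtain d1 d2 d3 where d: "d = (d1, d2, d3)" by (cases d)
  let ?D = "det3 a b c" and ?r = "det3 d b c" and ?s = "det3 a d c" and ?t = "det3 a b d"
  have e: "?D * d1 = ?r * a1 + ?s * b1 + ?t * c1"
     "?D * d2 = ?r * a2 + ?s * b2 + ?t * c2"
     "?D * d3 = ?r * a3 + ?s * b3 + ?t * c3"
    unfolding a b c d det3_def by (simp_all add: algebra_simps)
  have "d = comb3 (?r / ?D, ?s / ?D, ?t / ?D) a b c"
    using e assms by (simp add: a b c d field_simps)
  then show ?thesis by blast
qed

text \<open>With the reference triangle as second triangle, Desargues' theorem is a polynomial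
  identity: the determinant testing collinearity of the meets of corresponding sides factors into
  the determinant of the first triangle and the one testing concurrency of the joins of
  corresponding vertices.\<close>

lemma desargues_coordinates:
  fixes u v w :: "'a::comm_ring_1 triple"
  defines "e1 \<equiv> (1, 0, 0)" and "e2 \<equiv> (0, 1, 0)" and "e3 \<equiv> (0, 0, 1)"
  shows "det3 (cross (cross v w) (cross e2 e3)) (cross (cross w u) (cross e3 e1))
      (cross (cross u v) (cross e1 e2))
   = det3 u v w * det3 (cross u e1) (cross v e2) (cross w e3)"
  unfolding assms by (cases u; cases v; cases w) (simp add: det3_def algebra_simps)

text \<open>The direction from axis to centre. In the basis \<open>b1\<close>, \<open>b2\<close>,
  \<open>b3\<close> the second triangle becomes the reference triangle, and the determinants of both
  triangles cancel because they are non-zero.\<close>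

lemma desargues:
  fixes a1 a2 a3 b1 b2 b3 :: "'a::field triple"
  assumes a: "det3 a1 a2 a3 \<noteq> 0" and b: "det3 b1 b2 b3 \<noteq> 0"
    and axis: "det3 (cross (cross a2 a3) (cross b2 b3)) (cross (cross a3 a1) (cross b3 b1))
      (cross (cross a1 a2) (cross b1 b2)) = 0"
  shows "det3 (cross a1 b1) (cross a2 b2) (cross a3 b3) = 0"
proof -
  obtain u v w where uvw: "a1 = comb3 u b1 b2 b3" "a2 = comb3 v b1 b2 b3" "a3 = comb3 w b1 b2 b3"
    using comb3_coordinates[OF b] by metis
  have e: "b1 = comb3 (1, 0, 0) b1 b2 b3" "b2 = comb3 (0, 1, 0) b1 b2 b3" "b3 = comb3 (0, 0, 1) b1 b2 b3"
    by (cases b1; cases b2; cases b3; simp)+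
  have c: "cross b2 b3 = comb3 (cross (0, 1, 0) (0, 0, 1)) (cross b2 b3) (cross b3 b1) (cross b1 b2)"
    "cross b3 b1 = comb3 (cross (0, 0, 1) (1, 0, 0)) (cross b2 b3) (cross b3 b1) (cross b1 b2)"
    "cross b1 b2 = comb3 (cross (1, 0, 0) (0, 1, 0)) (cross b2 b3) (cross b3 b1) (cross b1 b2)"
    by (cases "cross b2 b3"; cases "cross b3 b1"; cases "cross b1 b2"; simp)+
  have l: "cross a1 b1 = comb3 (cross u (1, 0, 0)) (cross b2 b3) (cross b3 b1) (cross b1 b2)"
    "cross a2 b2 = comb3 (cross v (0, 1, 0)) (cross b2 b3) (cross b3 b1) (cross b1 b2)"
    "cross a3 b3 = comb3 (cross w (0, 0, 1)) (cross b2 b3) (cross b3 b1) (cross b1 b2)"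
    using cross_comb3[of _ b1 b2 b3] e uvw by metis+
  \<comment> \<open>Meets of lines transform by the cofactor matrix of the cofactor matrix, whose
    determinant is the fourth power of \<open>det3 b1 b2 b3\<close>.\<close>
  have "cross (cross a2 a3) (cross b2 b3) = comb3 (cross (cross v w) (cross (0, 1, 0) (0, 0, 1)))
     (cross (cross b3 b1) (cross b1 b2)) (cross (cross b1 b2) (cross b2 b3)) (cross (cross b2 b3) (cross b3 b1))"
    "cross (cross a3 a1) (cross b3 b1) = comb3 (cross (cross w u) (cross (0, 0, 1) (1, 0, 0)))
     (cross (cross b3 b1) (cross b1 b2)) (cross (cross b1 b2) (cross b2 b3)) (cross (cross b2 b3) (cross b3 b1))"
    "cross (cross a1 a2) (cross b1 b2) = comb3 (cross (cross u v) (cross (1, 0, 0) (0, 1, 0)))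
     (cross (cross b3 b1) (cross b1 b2)) (cross (cross b1 b2) (cross b2 b3)) (cross (cross b2 b3) (cross b3 b1))"
    using cross_comb3[of _ b1 b2 b3] cross_comb3[of _ "cross b2 b3" "cross b3 b1" "cross b1 b2"] c uvw by metis+
  moreover have "det3 (cross (cross b3 b1) (cross b1 b2)) (cross (cross b1 b2) (cross b2 b3)) (cross (cross b2 b3) (cross b3 b1)) \<noteq> 0"
    using b by (simp add: det3_cross)
  ultimately have "det3 u v w * det3 (cross u (1, 0, 0)) (cross v (0, 1, 0)) (cross w (0, 0, 1)) = 0"
    using axis desargues_coordinates[of v w u] by (simp add: det3_comb3)
  moreover have "det3 u v w \<noteq> 0" using a uvw by (auto simp: det3_comb3)
  ultimately show ?thesis unfolding l by (simp add: det3_comb3)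
qed

section \<open>Coordinatization of representations of the affine plane\<close>

text \<open>The right-hand side is collinearity in the affine plane. Degenerate triples are
  included, since repeated points make both sides true.\<close>

definition plane_rep :: "('k::field \<Rightarrow> 'k \<Rightarrow> 'f::field triple) \<Rightarrow> bool" where
  "plane_rep \<phi> \<longleftrightarrow> (\<forall>x1 y1 x2 y2 x3 y3. det3 (\<phi> x1 y1) (\<phi> x2 y2) (\<phi> x3 y3) = 0 \<longleftrightarrow>
     (x2 - x1) * (y3 - y1) = (x3 - x1) * (y2 - y1))"

lemma plane_repD:
  "plane_rep \<phi> \<Longrightarrow> det3 (\<phi> x1 y1) (\<phi> x2 y2) (\<phi> x3 y3) = 0 \<longleftrightarrow>
     (x2 - x1) * (y3 - y1) = (x3 - x1) * (y2 - y1)"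
  by (simp add: plane_rep_def)

lemma plane_rep_transpose: "plane_rep \<phi> \<Longrightarrow> plane_rep (\<lambda>x y. \<phi> y x)"
  unfolding plane_rep_def by (metis mult.commute)

lemma plane_rep_nonzero:
  assumes "plane_rep \<phi>" shows "\<phi> x y \<noteq> (0, 0, 0)"
proof
  assume "\<phi> x y = (0, 0, 0)"
  then have "det3 (\<phi> x y) (\<phi> (x + 1) y) (\<phi> x (y + 1)) = 0"
    by (cases "\<phi> (x + 1) y"; cases "\<phi> x (y + 1)") (simp add: det3_def)
  then show False by (simp add: plane_repD[OF assms])
qed

section \<open>Concurrency of the lines of a parallel class\<close>

lemma vertical_cross:
  assumes \<phi>: "plane_rep \<phi>" and "y \<noteq> y'"
  obtains k where "cross (\<phi> a z) (\<phi> a z') = comb k (cross (\<phi> a y) (\<phi> a y')) 0 (cross (\<phi> a y) (\<phi> a y'))"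
proof -
  have 1: "det3 (\<phi> a y) (\<phi> a y') (\<phi> (a + 1) y) \<noteq> 0"
    using assms by (simp add: plane_repD[OF \<phi>])
  have 2: "det3 (\<phi> a y) (\<phi> a y') (\<phi> a z) = 0" for z
    using assms by (simp add: plane_repD[OF \<phi>])
  obtain r s r' s' where "\<phi> a z = comb r (\<phi> a y) s (\<phi> a y')" "\<phi> a z' = comb r' (\<phi> a y) s' (\<phi> a y')"
    using cramer[OF 2 1] by metis
  then show ?thesis using that by (simp add: cross_comb)
qed

lemma parallel_if_cross_0:
  fixes q P :: "'a::field triple"
  assumes "cross q P = (0, 0, 0)" "P \<noteq> (0, 0, 0)"
  obtains k where "q = comb k P 0 P"
proof -
  obtain q1 q2 q3 where q: "q = (q1, q2, q3)" by (cases q)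
  obtain p1 p2 p3 where p: "P = (p1, p2, p3)" by (cases P)
  have c: "q2 * p3 = q3 * p2" "q3 * p1 = q1 * p3" "q1 * p2 = q2 * p1"
    using assms(1) by (simp_all add: q p)
  consider "p1 \<noteq> 0" | "p2 \<noteq> 0" | "p3 \<noteq> 0" using assms(2) p by auto
  then show ?thesis
  proof cases
    case 1
    then have "q = comb (q1 / p1) P 0 P" using c by (simp add: q p field_simps)
    then show ?thesis by (rule that)
  next
    case 2
    then have "q = comb (q2 / p2) P 0 P" using c by (simp add: q p field_simps)
    then show ?thesis by (rule that)
  next
    case 3
    then have "q = comb (q3 / p3) P 0 P" using c by (simp add: q p field_simps)
    then show ?thesis by (rule that)
  qed
qed

text \<open>Expanding the double cross product shows that \<open>cross m n\<close> is parallel to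
  any common point \<open>P\<close>; the value \<open>k = 0\<close> covers proportional
  \<open>m\<close> and \<open>n\<close>.\<close>

lemma intersection_unique:
  fixes P :: "'a::field triple"
  assumes "dot m P = 0" "dot n P = 0" "P \<noteq> (0, 0, 0)"
  obtains k where "cross m n = comb k P 0 P"
proof -
  have "cross (cross m n) P = comb (dot m P) n (- dot n P) m"
    by (cases m; cases n; cases P) (simp add: algebra_simps)
  also have "\<dots> = (0, 0, 0)" using assms by (cases m; cases n) simp
  finally show ?thesis using parallel_if_cross_0 assms(3) that by metis
qed

lemma det3_scale:
  "det3 (comb r a 0 a) (comb s b 0 b) (comb t c 0 c) = r * s * t * det3 a b c"
  by (cases a; cases b; cases c) (simp add: det3_def algebra_simps)

text \<open>Two triangles have one vertex in each of the three columns, and their corresponding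
  sides meet on the row \<open>y = 0\<close>. By Desargues the joins of corresponding vertices,
  which are the columns, are concurrent.\<close>

lemma three_verticals_concurrent:
  fixes \<phi> :: "'k::{field,finite} \<Rightarrow> 'k \<Rightarrow> 'f::field triple"
  assumes \<phi>: "plane_rep \<phi>" and card: "CARD('k) > 3"
    and a: "a1 \<noteq> a2" "a1 \<noteq> a3" "a2 \<noteq> a3"
  shows "det3 (cross (\<phi> a1 0) (\<phi> a1 1)) (cross (\<phi> a2 0) (\<phi> a2 1)) (cross (\<phi> a3 0) (\<phi> a3 1)) = 0"
proof -
  have ex: "\<exists>x::'k. x \<notin> S" if "card S \<le> 3" for S :: "'k set"
    using that card by (metis UNIV_eq_I not_le)
  \<comment> \<open>With this height the points \<open>(a1, 1)\<close>, \<open>(a2, y2)\<close>, \<open>(a3, y3)\<close> are collinear only for \<open>y3 = 0\<close>,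
    which is excluded anyway; hence four elements suffice. The second triangle is the first one
    scaled vertically by \<open>l\<close>, so that corresponding sides meet on the axis \<open>y = 0\<close>.\<close>
  define y2 where "y2 = 1 - (a2 - a1) / (a3 - a1)"
  have y2: "y2 \<noteq> 0" "y2 \<noteq> 1" using a by (auto simp: y2_def field_simps)
  obtain y3 where y3: "y3 \<notin> {0, 1, y2}" using ex[of "{0, 1, y2}"] card_insert_le_m1 
    by (metis card_length list.set(1) list.set(2) length_Cons list.size(3) numeral_3_eq_3)
  obtain l where l: "l \<notin> {0::'k, 1}" using ex[of "{0, 1}"] by auto
  have y: "(a3 - a1) * (y2 - 1) = - (a2 - a1)" using a by (simp add: y2_def)
  have A: "det3 (\<phi> a1 1) (\<phi> a2 y2) (\<phi> a3 y3) \<noteq> 0"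
  proof
    assume "det3 (\<phi> a1 1) (\<phi> a2 y2) (\<phi> a3 y3) = 0"
    then have "(a2 - a1) * (y3 - 1) = - (a2 - a1)" by (simp add: plane_repD[OF \<phi>] y)
    then have "(a2 - a1) * y3 = 0" by (simp add: algebra_simps)
    then show False using a y3 by simp
  qed
  have B: "det3 (\<phi> a1 l) (\<phi> a2 (l * y2)) (\<phi> a3 (l * y3)) \<noteq> 0"
  proof
    assume "det3 (\<phi> a1 l) (\<phi> a2 (l * y2)) (\<phi> a3 (l * y3)) = 0"
    then have "l * ((a2 - a1) * (y3 - 1)) = l * ((a3 - a1) * (y2 - 1))"
      by (simp add: plane_repD[OF \<phi>] algebra_simps)
    then have "det3 (\<phi> a1 1) (\<phi> a2 y2) (\<phi> a3 y3) = 0" using l by (simp add: plane_repD[OF \<phi>])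
    then show False using A by simp
  qed
  have P: "\<exists>x k. cross (cross (\<phi> b u) (\<phi> c v)) (cross (\<phi> b (l * u)) (\<phi> c (l * v))) = comb k (\<phi> x 0) 0 (\<phi> x 0)"
    if "u \<noteq> v" for b c u v
  proof -
    \<comment> \<open>The line through \<open>(b, u)\<close> and \<open>(c, v)\<close> meets the
      axis at this abscissa, which does not change when both heights are multiplied by
      \<open>l\<close>.\<close>
    define x where "x = (b * v - c * u) / (v - u)"
    have x: "x * (v - u) = b * v - c * u" using that by (simp add: x_def)
    have x': "x * (l * v) - x * (l * u) = l * (b * v - c * u)"
      using x by (metis mult.left_commute right_diff_distrib)
    have "det3 (\<phi> b u) (\<phi> c v) (\<phi> x 0) = 0"
      "det3 (\<phi> b (l * u)) (\<phi> c (l * v)) (\<phi> x 0) = 0"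
      using x x' by (auto simp: plane_repD[OF \<phi>] algebra_simps)
    then have "dot (cross (\<phi> b u) (\<phi> c v)) (\<phi> x 0) = 0"
      "dot (cross (\<phi> b (l * u)) (\<phi> c (l * v))) (\<phi> x 0) = 0" by (simp_all add: det3_def)
    then show ?thesis using intersection_unique plane_rep_nonzero[OF \<phi>] by metis
  qed
  obtain x1 k1 where P1: "cross (cross (\<phi> a2 y2) (\<phi> a3 y3)) (cross (\<phi> a2 (l * y2)) (\<phi> a3 (l * y3)))
      = comb k1 (\<phi> x1 0) 0 (\<phi> x1 0)" using P[of y2 y3 a2 a3] y3 by auto
  obtain x2 k2 where P2: "cross (cross (\<phi> a3 y3) (\<phi> a1 1)) (cross (\<phi> a3 (l * y3)) (\<phi> a1 l))
      = comb k2 (\<phi> x2 0) 0 (\<phi> x2 0)" using P[of y3 1 a3 a1] y3 by auto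
  obtain x3 k3 where P3: "cross (cross (\<phi> a1 1) (\<phi> a2 y2)) (cross (\<phi> a1 l) (\<phi> a2 (l * y2)))
      = comb k3 (\<phi> x3 0) 0 (\<phi> x3 0)" using P[of 1 y2 a1 a2] y2 by auto
  have "det3 (\<phi> x1 0) (\<phi> x2 0) (\<phi> x3 0) = 0" by (simp add: plane_repD[OF \<phi>])
  then have D: "det3 (cross (\<phi> a1 1) (\<phi> a1 l)) (cross (\<phi> a2 y2) (\<phi> a2 (l * y2))) (cross (\<phi> a3 y3) (\<phi> a3 (l * y3))) = 0"
    using desargues[OF A B] by (simp add: P1 P2 P3 det3_scale)
  \<comment> \<open>Desargues yields each column as the join of its two triangle vertices, distinct
    because the heights are non-zero and \<open>l\<close> is not 1; any other pair of points in the
    column gives the same line up to a factor.\<close>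
  obtain k1 where 1: "cross (\<phi> a1 0) (\<phi> a1 1) = comb k1 (cross (\<phi> a1 1) (\<phi> a1 l)) 0 (cross (\<phi> a1 1) (\<phi> a1 l))"
    by (rule vertical_cross[OF \<phi>, of 1 l a1 0 1]) (use l in auto)
  obtain k2 where 2: "cross (\<phi> a2 0) (\<phi> a2 1) = comb k2 (cross (\<phi> a2 y2) (\<phi> a2 (l * y2))) 0 (cross (\<phi> a2 y2) (\<phi> a2 (l * y2)))"
    by (rule vertical_cross[OF \<phi>, of y2 "l * y2" a2 0 1]) (use l y2 in auto)
  obtain k3 where 3: "cross (\<phi> a3 0) (\<phi> a3 1) = comb k3 (cross (\<phi> a3 y3) (\<phi> a3 (l * y3))) 0 (cross (\<phi> a3 y3) (\<phi> a3 (l * y3)))"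
    by (rule vertical_cross[OF \<phi>, of y3 "l * y3" a3 0 1]) (use l y3 in auto)
  show ?thesis unfolding 1 2 3 det3_scale D by simp
qed

text \<open>Columns 0 and 1 determine the candidate for the common point, and every further column
  passes through it by the three-column case.\<close>

lemma verticals_concurrent:
  fixes \<phi> :: "'k::{field,finite} \<Rightarrow> 'k \<Rightarrow> 'f::field triple"
  assumes \<phi>: "plane_rep \<phi>" and card: "CARD('k) > 3"
  obtains V where "V \<noteq> (0, 0, 0)" "\<And>a y y'. det3 (\<phi> a y) (\<phi> a y') V = 0"
proof -
  define L where "L a = cross (\<phi> a 0) (\<phi> a 1)" for a
  define V where "V = cross (L 0) (L 1)"
  have L: "dot (L a) V = 0" for a
  proof (cases "a = 0 \<or> a = 1")
    case True
    then show ?thesis unfolding V_def by (metis cross_dot dot_comm)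
  next
    case False
    then have "det3 (L 0) (L 1) (L a) = 0"
      unfolding L_def by (intro three_verticals_concurrent[OF \<phi> card]) auto
    then show ?thesis unfolding V_def det3_def by (simp add: dot_comm)
  qed
  \<comment> \<open>If \<open>V\<close> were zero, columns 0 and 1 would span the same line, and
    \<open>(1, 0)\<close> would become collinear with column 0.\<close>
  have "V \<noteq> (0, 0, 0)"
  proof
    assume "V = (0, 0, 0)"
    have 1: "dot (L 1) (\<phi> 0 0) \<noteq> 0" "dot (L 0) (\<phi> 1 0) \<noteq> 0" "dot (L 1) (\<phi> 1 0) = 0"
      using plane_repD[OF \<phi>, of 1 0 1 1 0 0] plane_repD[OF \<phi>, of 0 0 0 1 1 0]
      by (simp_all add: L_def det3_def)
    then have "L 1 \<noteq> (0, 0, 0)" by (cases "\<phi> 0 0") auto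
    then obtain k where k: "L 0 = comb k (L 1) 0 (L 1)"
      using parallel_if_cross_0[of "L 0" "L 1"] \<open>V = (0, 0, 0)\<close> V_def by auto
    have "dot (comb k (L 1) 0 (L 1)) (\<phi> 1 0) = k * dot (L 1) (\<phi> 1 0)"
      by (cases "L 1"; cases "\<phi> 1 0") (simp add: algebra_simps)
    then show False using 1 k by simp
  qed
  moreover have "det3 (\<phi> a y) (\<phi> a y') V = 0" for a y y'
  proof -
    obtain k where k: "cross (\<phi> a y) (\<phi> a y') = comb k (L a) 0 (L a)"
      unfolding L_def by (rule vertical_cross[OF \<phi> zero_neq_one, of a y y'])
    have "dot (comb k (L a) 0 (L a)) V = k * dot (L a) V"
      by (cases "L a"; cases V) (simp add: algebra_simps)
    then show ?thesis unfolding det3_def k using L by simp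
  qed
  ultimately show ?thesis by (rule that)
qed

text \<open>\<open>V\<close> is a point at infinity: if it coincided with \<open>\<phi> a y\<close>,
  then \<open>\<phi> a y\<close> would lie on column \<open>b\<close>. Hence \<open>V\<close> and
  \<open>\<phi> a y\<close> span column \<open>a\<close>, which misses
  \<open>\<phi> b z\<close>.\<close>

lemma vertical_point_ne:
  assumes \<phi>: "plane_rep \<phi>" and V: "V \<noteq> (0, 0, 0)" "\<And>a y y'. det3 (\<phi> a y) (\<phi> a y') V = 0"
    and "a \<noteq> b"
  shows "det3 V (\<phi> a y) (\<phi> b z) \<noteq> 0"
proof -
  let ?P = "\<phi> a y" and ?Q = "\<phi> a (y + 1)"
  have nz: "det3 ?P ?Q (\<phi> b z) \<noteq> 0" using assms(4) by (simp add: plane_repD[OF \<phi>])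
  obtain r s where rs: "V = comb r ?P s ?Q" using cramer[OF V(2) nz] by blast
  have "s \<noteq> 0"
  proof
    assume "s = 0"
    then have "r \<noteq> 0" using rs V(1) by (cases ?P; cases ?Q) auto
    have "det3 V (\<phi> b z) (\<phi> b (z + 1)) = 0" using V(2) det3_cyclic by metis
    then have "r * det3 ?P (\<phi> b z) (\<phi> b (z + 1)) = 0"
      unfolding rs det3_comb_left using \<open>s = 0\<close> by simp
    then show False using \<open>r \<noteq> 0\<close> assms(4) by (auto simp: plane_repD[OF \<phi>])
  qed
  moreover have "det3 V ?P (\<phi> b z) = - s * det3 ?P ?Q (\<phi> b z)"
    unfolding rs det3_comb_left by (simp add: det3_swap[of ?P ?Q])
  ultimately show ?thesis using nz by simp
qed

section \<open>Affine coordinates and the final contradiction\<close>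

lemma det3_replace:
  "det3 (comb3 (r, s, t) a b c) b c = r * det3 a b c"
  "det3 a (comb3 (r, s, t) a b c) c = s * det3 a b c"
  "det3 a b (comb3 (r, s, t) a b c) = t * det3 a b c"
  by (cases a; cases b; cases c; simp add: det3_def algebra_simps)+

lemma affine_embedding_impossible:
  fixes f g :: "'k::{field,finite} \<Rightarrow> 'f::field_char_0"
  assumes h: "\<And>x1 y1 x2 y2 x3 y3. (f x2 - f x1) * (g y3 - g y1) = (f x3 - f x1) * (g y2 - g y1) \<longleftrightarrow>
     (x2 - x1) * (y3 - y1) = (x3 - x1) * (y2 - y1)"
    and f0: "f 0 = 0" and g0: "g 0 = 0" and f1: "f 1 = 1" and g1: "g 1 = 1"
    and card: "CARD('k) > 2"
  shows False
proof -
  \<comment> \<open>The next facts test \<open>h\<close> on the origin together with points of the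
    diagonal, of the row at height 1 and of the line of slope \<open>m\<close>; \<open>aff\<close>
    uses the line through \<open>(0, 1)\<close> of slope 1.\<close>
  have g: "g x = f x" for x using h[of 1 0 x 0 x 1] by (simp add: f0 g0 f1 g1)
  have inj: "f x = f y \<longleftrightarrow> x = y" for x y using h[of x 0 1 0 y 1] by (simp add: f0 g0 f1 g1)
  have mult: "f (m * x) = f m * f x" for m x
    using h[of 1 0 "m * x" 0 x m] by (simp add: f0 g0 f1 g mult.commute)
  define c where "c = f (1 + 1) - 1"
  have aff: "f (1 + x) = 1 + c * f x" for x
    using h[of 1 0 "1 + x" 1 x "1 + 1"] by (simp add: f0 f1 g c_def algebra_simps)
  \<comment> \<open>At \<open>- 1\<close> the relation \<open>aff\<close> reads
    \<open>0 = 1 + c * f (- 1)\<close>; as \<open>f (- 1)\<close> squares to 1, its sign determines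
    \<open>c\<close>.\<close>
  have m1: "c * f (- 1) = - 1" using aff[of "- 1"] by (simp add: f0 eq_neg_iff_add_eq_0 add.commute)
  have sq: "f (- 1) = 1 \<or> f (- 1) = - 1"
    using mult[of "- 1" "- 1"] by (metis f1 minus_mult_minus mult_1 square_eq_1_iff)
  show False
  proof (cases "- 1 = (1::'k)")
    case False
    then have "f (- 1) = - 1" using sq f1 inj by metis
    then have c: "c = 1" using m1 by simp
    \<comment> \<open>With \<open>c = 1\<close> the map \<open>f\<close> carries the multiples of 1
      in a finite field injectively into characteristic 0, but those multiples repeat.\<close>
    have nat: "f (of_nat n) = of_nat n" for n by (induction n) (simp_all add: f0 aff c)
    have "\<not> inj (of_nat :: nat \<Rightarrow> 'k)"
      using finite_imageD[of "of_nat :: nat \<Rightarrow> 'k" UNIV] infinite_UNIV_nat finite by metis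
    then obtain a b where "a \<noteq> b" "of_nat a = (of_nat b :: 'k)" unfolding inj_def by blast
    then show False using nat[of a] nat[of b] by simp
  next
    case True
    then have c: "c = - 1" using m1 f1 by (metis mult.right_neutral)
    obtain x :: 'k where x: "x \<notin> {0, 1}"
    proof -
      have "UNIV \<noteq> {0, 1 :: 'k}" using card by (metis card_2_iff less_irrefl zero_neq_one)
      then show ?thesis using that by blast
    qed
    \<comment> \<open>Since \<open>1 + x = x * (1 + 1 / x)\<close>, the value \<open>1 - f x\<close>
      also equals \<open>f x - 1\<close>; in characteristic 0 this forces
      \<open>f x = 1\<close>.\<close>
    have "f (1 + x) = f x * f (1 + 1 / x)" using x mult[of x "1 + 1 / x"] by (simp add: algebra_simps)
    also have "\<dots> = f x - f (x * (1 / x))" unfolding mult by (simp add: aff c algebra_simps)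
    also have "\<dots> = f x - 1" using x f1 by simp
    finally have "f x = 1" by (simp add: aff c)
    then show False using x inj[of x 1] f1 by simp
  qed
qed

text \<open>Rows are the columns of the transposed map, so both classes have a common point. Taking
  the line through these two points as the line at infinity turns \<open>\<phi>\<close> into a
  product map in affine coordinates.\<close>

lemma no_plane_rep:
  fixes \<phi> :: "'k::{field,finite} \<Rightarrow> 'k \<Rightarrow> 'f::field_char_0 triple"
  assumes \<phi>: "plane_rep \<phi>" and card: "CARD('k) > 3"
  shows False
proof -
  note \<phi>' = plane_rep_transpose[OF \<phi>]
  obtain V where V: "V \<noteq> (0, 0, 0)" "\<And>a y y'. det3 (\<phi> a y) (\<phi> a y') V = 0"
    using verticals_concurrent[OF \<phi> card] by blast
  obtain H where H: "H \<noteq> (0, 0, 0)" "\<And>b x x'. det3 (\<phi> x b) (\<phi> x' b) H = 0"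
    using verticals_concurrent[OF \<phi>' card] by blast
  have nH: "det3 H (\<phi> x a) (\<phi> z b) \<noteq> 0" if "a \<noteq> b" for a b x z
    using vertical_point_ne[OF \<phi>' H that] .
  \<comment> \<open>No image point lies on the line through \<open>H\<close> and \<open>V\<close>,
    so that line can serve as the line at infinity.\<close>
  have Z: "det3 H V (\<phi> a b) \<noteq> 0" for a b
  proof -
    let ?P = "\<phi> a b" and ?Q = "\<phi> a (b + 1)" and ?R = "\<phi> (a + 1) b"
    have "det3 ?P ?Q ?R \<noteq> 0" by (simp add: plane_repD[OF \<phi>])
    then obtain r s where rs: "V = comb r ?P s ?Q" using cramer V(2) by metis
    have "s \<noteq> 0"
    proof
      assume "s = 0"
      have "det3 V ?P ?R \<noteq> 0" by (intro vertical_point_ne[OF \<phi> V]) auto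
      then show False using \<open>s = 0\<close> by (simp add: rs det3_comb_left)
    qed
    have "det3 H V ?P = det3 V ?P H" by (metis det3_cyclic)
    also have "\<dots> = s * det3 ?Q ?P H" by (simp add: rs det3_comb_left)
    also have "\<dots> = s * det3 H ?Q ?P" by (metis det3_cyclic)
    finally show ?thesis using \<open>s \<noteq> 0\<close> nH by simp
  qed
  define O' where "O' = \<phi> 0 0"
  define D where "D = det3 H V O'"
  \<comment> \<open>By Cramer's rule these are \<open>D\<close> times the coordinates of
    \<open>\<phi> a b\<close> in the basis \<open>H\<close>, \<open>V\<close>,
    \<open>O'\<close>.\<close>
  define X Y Z where "X a b = det3 (\<phi> a b) V O'" and "Y a b = det3 H (\<phi> a b) O'"
    and "Z a b = det3 H V (\<phi> a b)" for a b
  have D: "D \<noteq> 0" unfolding D_def O'_def by (rule Z)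
  have Znz: "Z a b \<noteq> 0" for a b unfolding Z_def by (rule Z)
  define f g where "f a = X a 0 / Z a 0" and "g b = Y 0 b / Z 0 b" for a b
  \<comment> \<open>The points of column \<open>a\<close> are collinear with \<open>V\<close>, which
    makes \<open>X / Z\<close> independent of \<open>b\<close>; rows and \<open>H\<close> give the
    same for \<open>Y / Z\<close>.\<close>
  have f: "X a b = f a * Z a b" for a b
  proof -
    have "X a b * Z a 0 - X a 0 * Z a b = - D * det3 (\<phi> a b) (\<phi> a 0) V"
      unfolding X_def Z_def D_def
      by (cases "\<phi> a b"; cases "\<phi> a 0"; cases V; cases H; cases O') (simp add: det3_def algebra_simps)
    then have "X a b * Z a 0 = X a 0 * Z a b" using V(2) by simp
    then show ?thesis using Znz by (simp add: f_def field_simps)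
  qed
  have g: "Y a b = g b * Z a b" for a b
  proof -
    have "Y a b * Z 0 b - Y 0 b * Z a b = D * det3 (\<phi> a b) (\<phi> 0 b) H"
      unfolding Y_def Z_def D_def
      by (cases "\<phi> a b"; cases "\<phi> 0 b"; cases V; cases H; cases O') (simp add: det3_def algebra_simps)
    then have "Y a b * Z 0 b = Y 0 b * Z a b" using H(2) by simp
    then show ?thesis using Znz by (simp add: g_def field_simps)
  qed
  \<comment> \<open>The change of basis multiplies all determinants by one non-zero constant, so
    vanishing is preserved in both directions.\<close>
  have XYZ: "det3 (X a b, Y a b, Z a b) (X a' b', Y a' b', Z a' b') (X a'' b'', Y a'' b'', Z a'' b'')
     = D * D * det3 (\<phi> a b) (\<phi> a' b') (\<phi> a'' b'')" for a b a' b' a'' b''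
  proof -
    have "\<exists>u. \<phi> x y = comb3 u H V O'" for x y
      by (rule comb3_coordinates) (use D D_def in simp)
    moreover have "(X x y, Y x y, Z x y) = comb3 u (D, 0, 0) (0, D, 0) (0, 0, D)" if "\<phi> x y = comb3 u H V O'" for x y u
      by (cases u) (simp add: X_def Y_def Z_def D_def that det3_replace)
    ultimately have ex: "\<exists>u. \<phi> x y = comb3 u H V O' \<and> (X x y, Y x y, Z x y) = comb3 u (D, 0, 0) (0, D, 0) (0, 0, D)" for x y
      by blast
    from ex[of a b] obtain u where u: "\<phi> a b = comb3 u H V O'"
      "(X a b, Y a b, Z a b) = comb3 u (D, 0, 0) (0, D, 0) (0, 0, D)" by blast
    from ex[of a' b'] obtain u' where u': "\<phi> a' b' = comb3 u' H V O'"
      "(X a' b', Y a' b', Z a' b') = comb3 u' (D, 0, 0) (0, D, 0) (0, 0, D)" by blast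
    from ex[of a'' b''] obtain u'' where u'': "\<phi> a'' b'' = comb3 u'' H V O'"
      "(X a'' b'', Y a'' b'', Z a'' b'') = comb3 u'' (D, 0, 0) (0, D, 0) (0, 0, D)" by blast
    have "det3 (D, 0, 0) (0, D, 0) (0, 0, D) = D * D * D" by (simp add: det3_def)
    then show ?thesis unfolding u u' u'' det3_comb3 D_def[symmetric] by (simp only: mult_ac)
  qed
  have key: "(f a' - f a) * (g b'' - g b) = (f a'' - f a) * (g b' - g b) \<longleftrightarrow>
     (a' - a) * (b'' - b) = (a'' - a) * (b' - b)" for a b a' b' a'' b''
  proof -
    have "det3 (X a b, Y a b, Z a b) (X a' b', Y a' b', Z a' b') (X a'' b'', Y a'' b'', Z a'' b'')
      = Z a b * Z a' b' * Z a'' b'' * ((f a' - f a) * (g b'' - g b) - (f a'' - f a) * (g b' - g b))"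
      unfolding f g by (simp add: det3_def algebra_simps)
    then have "(f a' - f a) * (g b'' - g b) - (f a'' - f a) * (g b' - g b) = 0 \<longleftrightarrow>
       det3 (\<phi> a b) (\<phi> a' b') (\<phi> a'' b'') = 0" using D Znz unfolding XYZ by (metis mult_eq_0_iff)
    then show ?thesis using plane_repD[OF \<phi>] by simp
  qed
  have 0: "f 0 = 0" "g 0 = 0" by (simp_all add: f_def g_def X_def Y_def O'_def)
  have 1: "f 1 \<noteq> 0" "g 1 \<noteq> 0" using key[of 1 0 1 0 0 0] 0 by auto
  \<comment> \<open>Rescaling both axes sends 1 to 1 and leaves the collinearity criterion
    intact.\<close>
  have "(f a' / f 1 - f a / f 1) * (g b'' / g 1 - g b / g 1) = (f a'' / f 1 - f a / f 1) * (g b' / g 1 - g b / g 1) \<longleftrightarrow>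
     (a' - a) * (b'' - b) = (a'' - a) * (b' - b)" for a b a' b' a'' b''
    using 1 by (simp only: diff_divide_distrib[symmetric] times_divide_times_eq divide_cancel_right mult_eq_0_iff key simp_thms)
  then show False
    by (rule affine_embedding_impossible[of "\<lambda>x. f x / f 1" "\<lambda>x. g x / g 1"]) (use 0 1 card in auto)
qed

section \<open>Flats of the affine matroid and realizations\<close>

lemma matroid_rank_ge:
  assumes "matroid M" "indep M I" "I \<subseteq> X"
  shows "card I \<le> matroid_rank M X"
proof -
  have "{I. I \<subseteq> X \<and> indep M I} \<subseteq> Pow (ground M)" "finite (ground M)"
    using assms(1) by (auto simp: matroid_def)
  then have "finite {I. I \<subseteq> X \<and> indep M I}" using finite_subset by blast
  then show ?thesis unfolding matroid_rank_def using assms by (intro Max_ge) auto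
qed

lemma matroid_rank_attained:
  assumes "matroid M"
  obtains I where "I \<subseteq> X" "indep M I" "card I = matroid_rank M X"
proof -
  have "{I. I \<subseteq> X \<and> indep M I} \<subseteq> Pow (ground M)" "finite (ground M)" "indep M {}"
    using assms(1) by (auto simp: matroid_def)
  then have "finite {I. I \<subseteq> X \<and> indep M I}" "{} \<in> {I. I \<subseteq> X \<and> indep M I}" using finite_subset by blast+
  then have "Max (card ` {I. I \<subseteq> X \<and> indep M I}) \<in> card ` {I. I \<subseteq> X \<and> indep M I}"
    by (intro Max_in) auto
  then obtain I where "I \<in> {I. I \<subseteq> X \<and> indep M I}" "Max (card ` {I. I \<subseteq> X \<and> indep M I}) = card I"
    by (rule imageE)
  then show ?thesis by (intro that[of I]) (simp_all add: matroid_rank_def)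
qed

lemma flats_empty:
  assumes "simple_matroid M" shows "{} \<in> flats M"
proof -
  have M: "matroid M" using assms by (simp add: simple_matroid_def)
  have "matroid_rank M {} < matroid_rank M (insert x {})" if "x \<in> ground M" for x
  proof -
    have "matroid_rank M {} = 0" by (rule matroid_rank_attained[OF M, of "{}"]) auto
    moreover have "card {x} \<le> matroid_rank M {x}"
      using assms that by (intro matroid_rank_ge[OF M]) (auto simp: simple_matroid_def)
    ultimately show ?thesis by simp
  qed
  then show ?thesis by (simp add: flats_def)
qed

lemma flats_singleton:
  assumes "simple_matroid M" "u \<in> ground M" shows "{u} \<in> flats M"
proof -
  have M: "matroid M" using assms by (simp add: simple_matroid_def)
  have "matroid_rank M {u} < matroid_rank M (insert x {u})" if "x \<in> ground M - {u}" for x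
  proof -
    obtain I where "I \<subseteq> {u}" "card I = matroid_rank M {u}" by (rule matroid_rank_attained[OF M])
    then have "matroid_rank M {u} \<le> 1" using card_mono[of "{u}" I] by simp
    moreover have "card {x, u} \<le> matroid_rank M {x, u}"
      using assms that by (intro matroid_rank_ge[OF M]) (auto simp: simple_matroid_def)
    ultimately show ?thesis using that by simp
  qed
  then show ?thesis using assms by (simp add: flats_def)
qed

lemma flat_memI:
  assumes "matroid M" "F \<in> flats M" "x \<in> ground M"
    and "\<And>I. indep M I \<Longrightarrow> I \<subseteq> insert x F \<Longrightarrow> card I \<le> matroid_rank M F"
  shows "x \<in> F"
proof (rule ccontr)
  assume "x \<notin> F"
  then have "matroid_rank M F < matroid_rank M (insert x F)" using assms(2,3) by (auto simp: flats_def)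
  moreover obtain I where "I \<subseteq> insert x F" "indep M I" "card I = matroid_rank M (insert x F)"
    by (rule matroid_rank_attained[OF assms(1)])
  ultimately show False using assms(4)[of I] by simp
qed

section \<open>Flats of the affine matroid\<close>

lemma matroid_affine: "matroid (affine_matroid m :: 'k::{field,finite} vec matroid)"
  using simple_affine_matroid[where ?'k = 'k, of m] unfolding simple_matroid_def by (rule conjunct1)

lemma indep_affine_matroid:
  "indep (affine_matroid m) X \<longleftrightarrow> X \<subseteq> carrier_vec m \<and> card X \<le> 3 \<and> (card X = 3 \<longrightarrow> \<not> collinear_in m X)"
  by (simp add: affine_matroid_def)

lemma ground_affine_matroid [simp]: "ground (affine_matroid m) = carrier_vec m"
  by (simp add: affine_matroid_def)

lemma affine_line_subset: "affine_line m L \<Longrightarrow> L \<subseteq> carrier_vec m"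
  unfolding affine_line_def by auto

lemma affine_line_two_points:
  assumes "affine_line m (L :: 'k::field vec set)"
  obtains a b where "a \<in> L" "b \<in> L" "a \<noteq> b"
proof -
  obtain a v where a: "a \<in> carrier_vec m" "v \<in> carrier_vec m" "v \<noteq> 0\<^sub>v m" "L = {a + t \<cdot>\<^sub>v v | t. True}"
    using assms unfolding affine_line_def by blast
  obtain i where i: "i < m" "v $ i \<noteq> 0" using a by (metis carrier_vecD eq_vecI index_zero_vec)
  have "(a + 0 \<cdot>\<^sub>v v) $ i \<noteq> (a + 1 \<cdot>\<^sub>v v) $ i" using a i by simp
  then have "a + 0 \<cdot>\<^sub>v v \<noteq> a + 1 \<cdot>\<^sub>v v" by metis
  then show ?thesis using a that by blast
qed

lemma not_collinear_insert:
  assumes "affine_line m L" "u \<in> L" "v \<in> L" "u \<noteq> v" "w \<notin> L"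
  shows "\<not> collinear_in m {u, v, w}"
proof
  assume "collinear_in m {u, v, w}"
  then obtain L' where "affine_line m L'" "{u, v, w} \<subseteq> L'" by (auto simp: collinear_in_def)
  then show False using affine_line_unique[OF assms(1) _ assms(4,2,3), of L'] assms(5) by simp
qed

text \<open>A line contains no independent triple, so its rank is below 3, whereas two of its points
  and an outside point form such a triple.\<close>

lemma flats_line:
  assumes L: "affine_line m (L :: 'k::{field,finite} vec set)" shows "L \<in> flats (affine_matroid m)"
proof -
  let ?M = "affine_matroid m :: 'k vec matroid"
  have "matroid_rank ?M L < matroid_rank ?M (insert x L)" if "x \<in> carrier_vec m" "x \<notin> L" for x
  proof -
    obtain a b where ab: "a \<in> L" "b \<in> L" "a \<noteq> b" using affine_line_two_points[OF L] .
    obtain I where I: "I \<subseteq> L" "indep ?M I" "card I = matroid_rank ?M L"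
      by (rule matroid_rank_attained[OF matroid_affine])
    then have "matroid_rank ?M L \<noteq> 3" using L by (auto simp: indep_affine_matroid collinear_in_def)
    then have 2: "matroid_rank ?M L < 3" using I by (auto simp: indep_affine_matroid)
    have "card {a, b, x} \<le> matroid_rank ?M (insert x L)"
      using ab that affine_line_subset[OF L] not_collinear_insert[OF L ab that(2)]
      by (intro matroid_rank_ge[OF matroid_affine]) (auto simp: indep_affine_matroid card_insert_if)
    moreover have "a \<noteq> x" "b \<noteq> x" using ab that by blast+
    then have "card {a, b, x} = 3" using ab(3) by simp
    ultimately show ?thesis using 2 by simp
  qed
  then show ?thesis using affine_line_subset[OF L] by (auto simp: flats_def)
qed

text \<open>If the flat lies in the line, then \<open>{u, v}\<close> already attains the rank of the
  flat enlarged by \<open>w\<close>. Otherwise \<open>u\<close>, \<open>v\<close> and a point off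
  the line attain the maximal rank 3. In both cases adding \<open>w\<close> does not raise the
  rank.\<close>

lemma flat_collinear_closed:
  fixes F :: "'k::{field,finite} vec set"
  assumes F: "F \<in> flats (affine_matroid m)" and "u \<in> F" "v \<in> F" "u \<noteq> v" "w \<in> carrier_vec m"
    and "collinear_in m {u, v, w}"
  shows "w \<in> F"
proof -
  let ?M = "affine_matroid m :: 'k vec matroid"
  have Fc: "F \<subseteq> carrier_vec m" using F by (simp add: flats_def)
  obtain L where L: "affine_line m L" "{u, v, w} \<subseteq> L" using assms(6) by (auto simp: collinear_in_def)
  show ?thesis
  proof (rule flat_memI[OF matroid_affine F])
    fix I assume I: "indep ?M I" "I \<subseteq> insert w F"
    show "card I \<le> matroid_rank ?M F"
    proof (cases "F \<subseteq> L")
      case True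
      then have "collinear_in m I" using I L by (auto simp: collinear_in_def)
      then have "card I \<le> card {u, v}" using I assms(4) by (auto simp: indep_affine_matroid)
      also have "\<dots> \<le> matroid_rank ?M F"
        using assms Fc by (intro matroid_rank_ge[OF matroid_affine]) (auto simp: indep_affine_matroid)
      finally show ?thesis .
    next
      case False
      then obtain z where z: "z \<in> F" "z \<notin> L" by blast
      have "u \<noteq> z" "v \<noteq> z" using z L by blast+
      then have "card {u, v, z} = 3" using assms(4) by simp
      then have "card I \<le> card {u, v, z}" using I by (simp add: indep_affine_matroid)
      also have "\<dots> \<le> matroid_rank ?M F"
        using assms Fc z not_collinear_insert[OF L(1), of u v z] L
        by (intro matroid_rank_ge[OF matroid_affine]) (auto simp: indep_affine_matroid card_insert_if)
      finally show ?thesis .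
    qed
  qed (use assms in simp)
qed

text \<open>Three non-collinear points attain the maximal rank 3, so no further point can raise the
  rank.\<close>

lemma flat_spanned:
  fixes F :: "'k::{field,finite} vec set"
  assumes F: "F \<in> flats (affine_matroid m)" and uvw: "u \<in> F" "v \<in> F" "w \<in> F" "card {u, v, w} = 3"
    and nc: "\<not> collinear_in m {u, v, w}" and z: "z \<in> carrier_vec m"
  shows "z \<in> F"
proof (rule flat_memI[OF matroid_affine F])
  let ?M = "affine_matroid m :: 'k vec matroid"
  fix I assume I: "indep ?M I" "I \<subseteq> insert z F"
  have "card I \<le> card {u, v, w}" using I uvw by (simp add: indep_affine_matroid)
  also have "\<dots> \<le> matroid_rank ?M F"
    using F uvw nc by (intro matroid_rank_ge[OF matroid_affine]) (auto simp: indep_affine_matroid flats_def)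
  finally show "card I \<le> matroid_rank ?M F" .
qed (use z in simp)

section \<open>Hyperplanes and intersections corresponding to flats\<close>

locale lattice_realization =
  fixes M :: "'a matroid" and l :: nat and \<A> :: "complex vec set set" and f
  assumes simple: "simple_matroid M" and central: "central_arrangement l \<A>"
    and bij: "bij_betw f (flats M) (intersection_lattice l \<A>)"
    and antitone: "X \<in> flats M \<Longrightarrow> Y \<in> flats M \<Longrightarrow> X \<subseteq> Y \<longleftrightarrow> f Y \<subseteq> f X"
begin

lemma f_surj: "W \<in> intersection_lattice l \<A> \<Longrightarrow> \<exists>X \<in> flats M. f X = W"
  using bij_betw_imp_surj_on[OF bij] by (metis imageE)

lemma f_mem: "X \<in> flats M \<Longrightarrow> f X \<in> intersection_lattice l \<A>"
  using bij by (rule bij_betwE[rule_format])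

lemma f_carrier: "X \<in> flats M \<Longrightarrow> f X \<subseteq> carrier_vec l"
  by (drule f_mem) (auto simp: intersection_lattice_def)

lemma f_empty: "f {} = carrier_vec l"
proof -
  have "carrier_vec l \<in> intersection_lattice l \<A>"
    unfolding intersection_lattice_def by (intro CollectI exI[of _ "{}"]) auto
  then obtain X where X: "X \<in> flats M" "f X = carrier_vec l" using f_surj by blast
  then have "f X \<subseteq> f {}" using antitone[OF flats_empty[OF simple] X(1)] by simp
  then show ?thesis using X(2) f_carrier[OF flats_empty[OF simple]] by simp
qed

text \<open>\<open>f {u}\<close> lies in some member \<open>H\<close> of the arrangement because it
  is not the whole space. The flat corresponding to \<open>H\<close> is contained in
  \<open>{u}\<close> and is non-empty, \<open>H\<close> being a proper subspace, so
  \<open>f {u} = H\<close>.\<close>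

lemma f_point:
  assumes u: "u \<in> ground M"
  shows "\<exists>a. a \<in> carrier_vec l \<and> f {u} = {x \<in> carrier_vec l. a \<bullet> x = 0}"
proof -
  note fu = flats_singleton[OF simple u]
  obtain B where B: "B \<subseteq> \<A>" "f {u} = carrier_vec l \<inter> \<Inter> B"
    using f_mem[OF fu] unfolding intersection_lattice_def by blast
  have "\<not> f {} \<subseteq> f {u}" using antitone[OF fu flats_empty[OF simple]] by simp
  then obtain H where H: "H \<in> B" using B f_empty by auto
  then obtain a where a: "a \<in> carrier_vec l" "a \<noteq> 0\<^sub>v l" "H = {x \<in> carrier_vec l. a \<bullet> x = 0}"
    using B(1) central unfolding central_arrangement_def linear_hyperplane_def by blast
  have "H = carrier_vec l \<inter> \<Inter> {H}" using a by auto
  then have "H \<in> intersection_lattice l \<A>" using H B(1) unfolding intersection_lattice_def by blast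
  then obtain X where X: "X \<in> flats M" "f X = H" using f_surj by blast
  have "X \<subseteq> {u}" using antitone[OF X(1) fu] X(2) B(2) H by blast
  moreover have "X \<noteq> {}"
  proof
    assume "X = {}"
    then have H: "H = carrier_vec l" using f_empty X by simp
    obtain i where i: "i < l" "a $ i \<noteq> 0" using a(1,2) by (metis carrier_vecD eq_vecI index_zero_vec)
    have "unit_vec l i \<in> H" using H by simp
    then have "a \<bullet> unit_vec l i = 0" using a by simp
    then show False using a(1) i by (simp add: scalar_prod_right_unit)
  qed
  ultimately have "X = {u}" by blast
  then show ?thesis using X a by blast
qed

text \<open>This takes the place of the join of flats: the arrangement lattice is closed under
  intersection, and antitonicity turns the intersection into a flat above \<open>X\<close> and
  \<open>Y\<close>.\<close>

lemma f_meet: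
  assumes "X \<in> flats M" "Y \<in> flats M"
  shows "\<exists>F \<in> flats M. f F = f X \<inter> f Y \<and> X \<subseteq> F \<and> Y \<subseteq> F"
proof -
  obtain B where B: "B \<subseteq> \<A>" "f X = carrier_vec l \<inter> \<Inter> B"
    using f_mem[OF assms(1)] unfolding intersection_lattice_def by blast
  obtain C where C: "C \<subseteq> \<A>" "f Y = carrier_vec l \<inter> \<Inter> C"
    using f_mem[OF assms(2)] unfolding intersection_lattice_def by blast
  have "f X \<inter> f Y = carrier_vec l \<inter> \<Inter> (B \<union> C)" using B C by blast
  then have "f X \<inter> f Y \<in> intersection_lattice l \<A>"
    unfolding intersection_lattice_def using B(1) C(1) by blast
  then obtain F where F: "F \<in> flats M" "f F = f X \<inter> f Y" using f_surj by blast
  then show ?thesis using antitone[OF assms(1) F(1)] antitone[OF assms(2) F(1)] by blast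
qed

end

section \<open>From a realization to vectors in complex 3-space\<close>

lemma det3_mult:
  "det3 a b c * det3 x y z = det3 (dot a x, dot a y, dot a z) (dot b x, dot b y, dot b z) (dot c x, dot c y, dot c z)"
proof -
  obtain x1 x2 x3 where x: "x = (x1, x2, x3)" by (cases x)
  obtain y1 y2 y3 where y: "y = (y1, y2, y3)" by (cases y)
  obtain z1 z2 z3 where z: "z = (z1, z2, z3)" by (cases z)
  have "(dot v x, dot v y, dot v z) = comb3 v (x1, y1, z1) (x2, y2, z2) (x3, y3, z3)" for v
    unfolding x y z by (cases v) simp
  moreover have "det3 (x1, y1, z1) (x2, y2, z2) (x3, y3, z3) = det3 x y z"
    unfolding x y z by (simp add: det3_def algebra_simps)
  ultimately show ?thesis by (simp add: det3_comb3)
qed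

text \<open>Flats of an ambient space of any dimension \<open>l\<close> are brought down to
  dimension 3: three non-collinear base points span the matroid, so the hyperplane normals are
  determined by their values on a basis dual to the three base normals.\<close>

lemma realization_triples:
  fixes b1 b2 b3 :: "'k::{field,finite} vec"
  assumes real: "realizable_over_complex (affine_matroid m :: 'k vec matroid)"
    and base: "b1 \<in> carrier_vec m" "b2 \<in> carrier_vec m" "b3 \<in> carrier_vec m"
      "card {b1, b2, b3} = 3" "\<not> collinear_in m {b1, b2, b3}"
  obtains \<phi> :: "'k vec \<Rightarrow> complex triple" where
    "\<And>u v w. u \<in> carrier_vec m \<Longrightarrow> v \<in> carrier_vec m \<Longrightarrow> w \<in> carrier_vec m \<Longrightarrow> card {u, v, w} = 3 \<Longrightarrow>
       det3 (\<phi> u) (\<phi> v) (\<phi> w) = 0 \<longleftrightarrow> collinear_in m {u, v, w}"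
proof -
  let ?M = "affine_matroid m :: 'k vec matroid"
  obtain l \<A> f where "lattice_realization ?M l \<A> f"
    using real simple_affine_matroid unfolding realizable_over_complex_def lattice_realization_def by metis
  then interpret lattice_realization ?M l \<A> f .
  have "\<forall>u \<in> carrier_vec m. \<exists>a. a \<in> carrier_vec l \<and> f {u} = {x \<in> carrier_vec l. a \<bullet> x = 0}"
    using f_point by simp
  then obtain a where a: "\<And>u. u \<in> carrier_vec m \<Longrightarrow> a u \<in> carrier_vec l"
    and fa: "\<And>u. u \<in> carrier_vec m \<Longrightarrow> f {u} = {x \<in> carrier_vec l. a u \<bullet> x = 0}" by metis
  have pt: "{u} \<in> flats ?M" if "u \<in> carrier_vec m" for u
    using flats_singleton[OF simple] that by simp
  have coll: "f {u} \<inter> f {v} \<subseteq> f {w}"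
    if c: "u \<in> carrier_vec m" "v \<in> carrier_vec m" "w \<in> carrier_vec m" "u \<noteq> v" "collinear_in m {u, v, w}" for u v w
  proof -
    obtain F where F: "F \<in> flats ?M" "f F = f {u} \<inter> f {v}" "u \<in> F" "v \<in> F"
      using f_meet[OF pt[OF c(1)] pt[OF c(2)]] by auto
    then have "w \<in> F" using flat_collinear_closed c by blast
    then show ?thesis using antitone[OF pt[OF c(3)] F(1)] F(2) by simp
  qed
  \<comment> \<open>The line through \<open>u\<close> and \<open>v\<close> is a flat that does not
    contain \<open>w\<close>, so its image contains a vector on the first two hyperplanes but off
    the third. Scaling normalises the last value to 1.\<close>
  have ncoll: "\<exists>x \<in> carrier_vec l. a u \<bullet> x = 0 \<and> a v \<bullet> x = 0 \<and> a w \<bullet> x = 1"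
    if c: "u \<in> carrier_vec m" "v \<in> carrier_vec m" "w \<in> carrier_vec m" "card {u, v, w} = 3" "\<not> collinear_in m {u, v, w}" for u v w
  proof -
    have "u \<noteq> v" using c(4) by (auto simp: card_insert_if split: if_splits)
    then obtain L where L: "affine_line m L" "{u, v} \<subseteq> L"
      using collinear_pair[OF c(1,2)] by (auto simp: collinear_in_def)
    then have w: "w \<notin> L" using c(5) by (auto simp: collinear_in_def)
    have "f L \<subseteq> f {u}" "f L \<subseteq> f {v}" "\<not> f L \<subseteq> f {w}"
      using L w antitone[OF pt flats_line[OF L(1)]] c by auto
    then obtain x where x: "x \<in> carrier_vec l" "a u \<bullet> x = 0" "a v \<bullet> x = 0" "a w \<bullet> x \<noteq> 0"
      using fa c by auto
    show ?thesis
      by (rule bexI[of _ "(1 / (a w \<bullet> x)) \<cdot>\<^sub>v x"]) (use x a c in auto)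
  qed
  \<comment> \<open>A flat containing the base points is everything, so the common part of the three
    base hyperplanes lies in every hyperplane.\<close>
  have span: "x \<in> f {z}" if "x \<in> f {b1}" "x \<in> f {b2}" "x \<in> f {b3}" and z: "z \<in> carrier_vec m" for x z
  proof -
    obtain F where F: "F \<in> flats ?M" "f F = f {b1} \<inter> f {b2}" "b1 \<in> F" "b2 \<in> F"
      using f_meet[OF pt[OF base(1)] pt[OF base(2)]] by auto
    obtain G where G: "G \<in> flats ?M" "f G = f F \<inter> f {b3}" "F \<subseteq> G" "b3 \<in> G"
      using f_meet[OF F(1) pt[OF base(3)]] by auto
    then have "z \<in> G" using flat_spanned[OF G(1) _ _ G(4) base(4,5) z] F by blast
    then have "f G \<subseteq> f {z}" using antitone[OF pt[OF z] G(1)] by simp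
    then show ?thesis using that F(2) G(2) by blast
  qed
  \<comment> \<open>\<open>x1\<close>, \<open>x2\<close>, \<open>x3\<close> are dual to the normals
    of \<open>b1\<close>, \<open>b2\<close>, \<open>b3\<close>.\<close>
  obtain x1 where x1: "x1 \<in> carrier_vec l" "a b2 \<bullet> x1 = 0" "a b3 \<bullet> x1 = 0" "a b1 \<bullet> x1 = 1"
    using ncoll[of b2 b3 b1] base by (auto simp: insert_commute)
  obtain x2 where x2: "x2 \<in> carrier_vec l" "a b1 \<bullet> x2 = 0" "a b3 \<bullet> x2 = 0" "a b2 \<bullet> x2 = 1"
    using ncoll[of b1 b3 b2] base by (auto simp: insert_commute)
  obtain x3 where x3: "x3 \<in> carrier_vec l" "a b1 \<bullet> x3 = 0" "a b2 \<bullet> x3 = 0" "a b3 \<bullet> x3 = 1"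
    using ncoll[of b1 b2 b3] base by auto
  define \<phi> where "\<phi> u = (a u \<bullet> x1, a u \<bullet> x2, a u \<bullet> x3)" for u
  \<comment> \<open>\<open>pr\<close> and \<open>\<eta>\<close> identify \<open>\<complex>\<^sup>3\<close> with the ambient space modulo the common intersection
    of all the hyperplanes, since the latter is cut out by those of \<open>b1\<close>, \<open>b2\<close>, \<open>b3\<close>.\<close>
  define pr where "pr = (\<lambda>(r, s, t). r \<cdot>\<^sub>v x1 + s \<cdot>\<^sub>v x2 + t \<cdot>\<^sub>v x3)"
  have pr: "pr y \<in> carrier_vec l" for y using x1 x2 x3 by (cases y) (simp add: pr_def)
  have dot_pr: "a u \<bullet> pr y = dot (\<phi> u) y" if "u \<in> carrier_vec m" for u y
    using a[OF that] x1 x2 x3 by (cases y) (simp add: pr_def \<phi>_def scalar_prod_add_distrib[of _ l] mult.commute)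
  define \<eta> where "\<eta> y = (a b1 \<bullet> y, a b2 \<bullet> y, a b3 \<bullet> y)" for y
  have dot_eta: "a u \<bullet> y = dot (\<phi> u) (\<eta> y)" if u: "u \<in> carrier_vec m" and y: "y \<in> carrier_vec l" for u y
  proof -
    \<comment> \<open>The three base normals annihilate \<open>y - pr (\<eta> y)\<close>, so by
      \<open>span\<close> every normal does.\<close>
    have "a b \<bullet> (y - pr (\<eta> y)) = 0" if "b \<in> {b1, b2, b3}" for b
      using that a base pr y x1 x2 x3
      by (auto simp: scalar_prod_minus_distrib[of _ l] dot_pr \<eta>_def \<phi>_def)
    then have "y - pr (\<eta> y) \<in> f {u}"
      using y pr base u by (intro span[OF _ _ _ u]) (auto simp: fa)
    then have "a u \<bullet> (y - pr (\<eta> y)) = 0" using fa[OF u] by simp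
    then show ?thesis using a[OF u] y pr by (simp add: scalar_prod_minus_distrib[of _ l] dot_pr[OF u])
  qed
  have "det3 (\<phi> u) (\<phi> v) (\<phi> w) = 0 \<longleftrightarrow> collinear_in m {u, v, w}"
    if c: "u \<in> carrier_vec m" "v \<in> carrier_vec m" "w \<in> carrier_vec m" "card {u, v, w} = 3" for u v w
  proof
    assume coll': "collinear_in m {u, v, w}"
    have "u \<noteq> v" using c(4) by (auto simp: card_insert_if split: if_splits)
    \<comment> \<open>The cross product is orthogonal to \<open>\<phi> u\<close> and
      \<open>\<phi> v\<close>; its lift lies on both hyperplanes, hence on that of
      \<open>w\<close>.\<close>
    let ?y = "pr (cross (\<phi> u) (\<phi> v))"
    have "?y \<in> f {u} \<inter> f {v}"
      using c pr by (simp add: fa dot_pr dot_comm[of "\<phi> u"] dot_comm[of "\<phi> v"])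
    then have "?y \<in> f {w}" using coll[OF c(1-3) \<open>u \<noteq> v\<close> coll'] by blast
    then show "det3 (\<phi> u) (\<phi> v) (\<phi> w) = 0"
      using c by (simp add: fa dot_pr det3_def dot_comm[of "\<phi> w"])
  next
    assume det: "det3 (\<phi> u) (\<phi> v) (\<phi> w) = 0"
    show "collinear_in m {u, v, w}"
    proof (rule ccontr)
      assume n: "\<not> collinear_in m {u, v, w}"
      \<comment> \<open>Vectors dual to the three normals exist, so the determinant times another
        one equals that of the identity matrix and cannot vanish.\<close>
      obtain y1 where y1: "y1 \<in> carrier_vec l" "a v \<bullet> y1 = 0" "a w \<bullet> y1 = 0" "a u \<bullet> y1 = 1"
        using ncoll[of v w u] c n by (auto simp: insert_commute)
      obtain y2 where y2: "y2 \<in> carrier_vec l" "a u \<bullet> y2 = 0" "a w \<bullet> y2 = 0" "a v \<bullet> y2 = 1"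
        using ncoll[of u w v] c n by (auto simp: insert_commute)
      obtain y3 where y3: "y3 \<in> carrier_vec l" "a u \<bullet> y3 = 0" "a v \<bullet> y3 = 0" "a w \<bullet> y3 = 1"
        using ncoll[of u v w] c n by auto
      have "det3 (\<phi> u) (\<phi> v) (\<phi> w) * det3 (\<eta> y1) (\<eta> y2) (\<eta> y3) = det3 (1, 0, 0) (0, 1, 0) (0, 0, 1)"
        unfolding det3_mult using c y1 y2 y3 by (simp flip: dot_eta)
      then show False using det by (simp add: det3_def)
    qed
  qed
  then show ?thesis using that by blast
qed

section \<open>A coordinate plane inside the affine space\<close>

definition plane_point :: "nat \<Rightarrow> 'k::field \<Rightarrow> 'k \<Rightarrow> 'k vec" where
  "plane_point m x y = vec m (\<lambda>i. if i = 0 then x else if i = 1 then y else 0)"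

lemma plane_point_carrier [simp]: "plane_point m x y \<in> carrier_vec m"
  by (simp add: plane_point_def)

lemma plane_point_inject:
  assumes "m \<ge> 2" shows "plane_point m x y = plane_point m x' y' \<longleftrightarrow> x = x' \<and> y = y'"
proof
  assume e: "plane_point m x y = plane_point m x' y'"
  have "plane_point m x y $ 0 = plane_point m x' y' $ 0" "plane_point m x y $ 1 = plane_point m x' y' $ 1"
    unfolding e by simp_all
  then show "x = x' \<and> y = y'" using assms by (simp add: plane_point_def)
qed simp

lemma collinear_plane_points:
  assumes m: "m \<ge> 2" and ne: "(x1, y1) \<noteq> (x2, y2)"
  shows "collinear_in m {plane_point m x1 y1, plane_point m x2 y2, plane_point m x3 y3} \<longleftrightarrow>
    (x2 - x1) * (y3 - y1) = (x3 - x1) * (y2 - (y1 :: 'k::field))"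
proof
  assume "collinear_in m {plane_point m x1 y1, plane_point m x2 y2, plane_point m x3 y3}"
  then obtain L where L: "affine_line m L" "plane_point m x1 y1 \<in> L" "plane_point m x2 y2 \<in> L" "plane_point m x3 y3 \<in> L"
    by (auto simp: collinear_in_def)
  then obtain a v where av: "a \<in> carrier_vec m" "v \<in> carrier_vec m" "L = {a + t \<cdot>\<^sub>v v | t. True}"
    unfolding affine_line_def by blast
  have *: "\<exists>t. x = a $ 0 + t * v $ 0 \<and> y = a $ 1 + t * v $ 1" if xy: "plane_point m x y \<in> L" for x y
  proof -
    obtain t where t: "plane_point m x y = a + t \<cdot>\<^sub>v v" using xy av by blast
    have "x = plane_point m x y $ 0" "y = plane_point m x y $ 1" using m by (simp_all add: plane_point_def)
    then show ?thesis using av m unfolding t by auto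
  qed
  obtain t1 t2 t3 where "x1 = a $ 0 + t1 * v $ 0" "y1 = a $ 1 + t1 * v $ 1"
    "x2 = a $ 0 + t2 * v $ 0" "y2 = a $ 1 + t2 * v $ 1" "x3 = a $ 0 + t3 * v $ 0" "y3 = a $ 1 + t3 * v $ 1"
    using *[OF L(2)] *[OF L(3)] *[OF L(4)] by blast
  then show "(x2 - x1) * (y3 - y1) = (x3 - x1) * (y2 - y1)" by (simp add: algebra_simps)
next
  assume e: "(x2 - x1) * (y3 - y1) = (x3 - x1) * (y2 - y1)"
  let ?v = "plane_point m (x2 - x1) (y2 - y1)"
  \<comment> \<open>The parameter of the third point on the line through the first two, read off
    from a coordinate in which these differ.\<close>
  obtain t where t: "x3 = x1 + t * (x2 - x1)" "y3 = y1 + t * (y2 - y1)"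
  proof (cases "x1 = x2")
    case True
    then have "y2 - y1 \<noteq> 0" using ne by simp
    then show ?thesis using e True by (intro that[of "(y3 - y1) / (y2 - y1)"]) simp_all
  next
    case False
    then show ?thesis using e by (intro that[of "(x3 - x1) / (x2 - x1)"]) (simp_all add: field_simps)
  qed
  have "?v \<noteq> 0\<^sub>v m"
  proof
    assume "?v = 0\<^sub>v m"
    then have "?v = plane_point m 0 0" by (auto simp: plane_point_def)
    then show False using ne by (simp add: plane_point_inject[OF m])
  qed
  then have "affine_line m {plane_point m x1 y1 + t \<cdot>\<^sub>v ?v | t. True}"
    unfolding affine_line_def by (intro bexI[of _ "plane_point m x1 y1"] bexI[of _ ?v]) auto
  moreover have "plane_point m x1 y1 = plane_point m x1 y1 + 0 \<cdot>\<^sub>v ?v"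
    "plane_point m x2 y2 = plane_point m x1 y1 + 1 \<cdot>\<^sub>v ?v"
    "plane_point m x3 y3 = plane_point m x1 y1 + t \<cdot>\<^sub>v ?v"
    by (auto simp: plane_point_def t intro!: eq_vecI)
  ultimately show "collinear_in m {plane_point m x1 y1, plane_point m x2 y2, plane_point m x3 y3}"
    unfolding collinear_in_def by blast
qed

theorem affine_matroid_not_realizable:
  assumes m: "m \<ge> 2" and card: "CARD('k::{field,finite}) > 3"
  shows "\<not> realizable_over_complex (affine_matroid m :: 'k vec matroid)"
proof
  assume real: "realizable_over_complex (affine_matroid m :: 'k vec matroid)"
  let ?p = "plane_point m :: 'k \<Rightarrow> 'k \<Rightarrow> 'k vec"
  note inj = plane_point_inject[OF m]
  have base: "card {?p 0 0, ?p 1 0, ?p 0 1} = 3" "\<not> collinear_in m {?p 0 0, ?p 1 0, ?p 0 1}"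
    using collinear_plane_points[OF m, of 0 0 1 0 0 1] by (simp_all add: card_insert_if inj)
  obtain \<phi> :: "'k vec \<Rightarrow> complex triple" where \<phi>:
    "\<And>u v w. u \<in> carrier_vec m \<Longrightarrow> v \<in> carrier_vec m \<Longrightarrow> w \<in> carrier_vec m \<Longrightarrow> card {u, v, w} = 3 \<Longrightarrow>
       det3 (\<phi> u) (\<phi> v) (\<phi> w) = 0 \<longleftrightarrow> collinear_in m {u, v, w}"
    using realization_triples[OF real _ _ _ base] by auto
  have "det3 (\<phi> (?p x1 y1)) (\<phi> (?p x2 y2)) (\<phi> (?p x3 y3)) = 0 \<longleftrightarrow>
     (x2 - x1) * (y3 - y1) = (x3 - x1) * (y2 - y1)" for x1 y1 x2 y2 x3 y3
  \<comment> \<open>\<open>\<phi>\<close> is controlled only on triples of distinct points; for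
    repeated points both sides hold.\<close>
  proof (cases "(x1, y1) = (x2, y2) \<or> (x1, y1) = (x3, y3) \<or> (x2, y2) = (x3, y3)")
    case True
    then show ?thesis by (auto simp: algebra_simps)
  next
    case False
    then have "card {?p x1 y1, ?p x2 y2, ?p x3 y3} = 3" by (auto simp: card_insert_if inj)
    then show ?thesis using \<phi> False collinear_plane_points[OF m, of x1 y1 x2 y2 x3 y3] by simp
  qed
  then have "plane_rep (\<lambda>x y. \<phi> (?p x y))" unfolding plane_rep_def by blast
  then show False using no_plane_rep card by blast
qed

section \<open>The Orlik--Solomon algebra in low degree\<close>

lemma tensor_algebra_ops [simp]:
  "x \<otimes>\<^bsub>tensor_algebra V\<^esub> y = x * y" "\<one>\<^bsub>tensor_algebra V\<^esub> = 1"
  "\<zero>\<^bsub>tensor_algebra V\<^esub> = 0" "x \<oplus>\<^bsub>tensor_algebra V\<^esub> y = x + y"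
  by (simp_all add: tensor_algebra_def)

lemma tensor_algebra_closed:
  "0 \<in> carrier (tensor_algebra V)" "1 \<in> carrier (tensor_algebra V)"
  "x \<in> carrier (tensor_algebra V) \<Longrightarrow> y \<in> carrier (tensor_algebra V) \<Longrightarrow> x + y \<in> carrier (tensor_algebra V)"
  "x \<in> carrier (tensor_algebra V) \<Longrightarrow> y \<in> carrier (tensor_algebra V) \<Longrightarrow> x * y \<in> carrier (tensor_algebra V)"
  "x \<in> carrier (tensor_algebra V) \<Longrightarrow> - x \<in> carrier (tensor_algebra V)"
proof -
  interpret ring "tensor_algebra V" by (rule ring_tensor_algebra)
  show "0 \<in> carrier (tensor_algebra V)" "1 \<in> carrier (tensor_algebra V)"
    using zero_closed one_closed by simp_all
  show "x + y \<in> carrier (tensor_algebra V)" "x * y \<in> carrier (tensor_algebra V)"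
    if "x \<in> carrier (tensor_algebra V)" "y \<in> carrier (tensor_algebra V)"
    using a_closed[OF that] m_closed[OF that] by simp_all
  show "- x \<in> carrier (tensor_algebra V)" if "x \<in> carrier (tensor_algebra V)"
    using that by (simp add: tensor_algebra_def)
qed

lemma tensor_algebra_sum_closed:
  "(\<And>i. i \<in> I \<Longrightarrow> x i \<in> carrier (tensor_algebra V)) \<Longrightarrow> sum x I \<in> carrier (tensor_algebra V)"
  by (induction I rule: infinite_finite_induct) (simp_all add: tensor_algebra_closed)

lemma tensor_algebra_of_nat_closed: "of_nat k \<in> carrier (tensor_algebra V)"
  by (induction k) (simp_all add: tensor_algebra_closed)

lemma tensor_algebra_of_int_closed: "of_int n \<in> carrier (tensor_algebra V)"
  by (cases n rule: int_cases2) (simp_all add: tensor_algebra_closed tensor_algebra_of_nat_closed)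

lemma tensor_algebra_minus:
  assumes "x \<in> carrier (tensor_algebra V)" shows "\<ominus>\<^bsub>tensor_algebra V\<^esub> x = - x"
proof -
  interpret ring "tensor_algebra V" by (rule ring_tensor_algebra)
  show ?thesis by (rule minus_equality[OF _ assms tensor_algebra_closed(5)[OF assms]]) simp
qed

lemma tensor_algebra_add_pow: "[n] \<cdot>\<^bsub>tensor_algebra V\<^esub> (1 :: 'a free_monoid \<Rightarrow>\<^sub>0 int) = of_int (n :: int)"
proof -
  interpret ring "tensor_algebra V" by (rule ring_tensor_algebra)
  have nat: "[k] \<cdot>\<^bsub>tensor_algebra V\<^esub> (1 :: 'a free_monoid \<Rightarrow>\<^sub>0 int) = of_nat k" for k :: nat
    by (induction k) (simp_all add: add.nat_pow_Suc)
  show ?thesis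
  proof (cases "n \<ge> 0")
    case True
    then show ?thesis by (simp add: add_pow_int_ge nat)
  next
    case False
    then have "[n] \<cdot>\<^bsub>tensor_algebra V\<^esub> (1 :: 'a free_monoid \<Rightarrow>\<^sub>0 int) = \<ominus>\<^bsub>tensor_algebra V\<^esub> of_nat (nat (- n))"
      by (simp add: add_pow_int_lt nat)
    also have "\<dots> = - of_nat (nat (- n))"
      by (rule tensor_algebra_minus) (rule tensor_algebra_of_nat_closed)
    also have "\<dots> = - of_int (int (nat (- n)))" by (simp only: of_int_of_nat_eq)
    also have "\<dots> = of_int n" using False by simp
    finally show ?thesis .
  qed
qed

lemma (in ring_hom_ring) hom_int_pow:
  assumes "x \<in> carrier R" shows "h ([(n :: int)] \<cdot>\<^bsub>R\<^esub> x) = [n] \<cdot>\<^bsub>S\<^esub> h x"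
proof -
  have nat: "h ([(k :: nat)] \<cdot>\<^bsub>R\<^esub> x) = [k] \<cdot>\<^bsub>S\<^esub> h x" for k
    using assms by (induction k) simp_all
  show ?thesis using assms by (cases "n \<ge> 0") (simp_all add: add_pow_int_ge add_pow_int_lt nat)
qed

text \<open>An ideal containing \<open>I\<close> is the full preimage of its image in the quotient
  by \<open>I\<close>.\<close>

lemma (in ring) mem_if_coset_mem:
  assumes "ideal I R" "ideal J R" "I \<subseteq> J" "x \<in> carrier R" "I +> x \<in> (+>) I ` J"
  shows "x \<in> J"
proof -
  interpret I: ideal I R by fact
  interpret J: ideal J R by fact
  obtain y where y: "y \<in> J" "I +> x = I +> y" using assms(5) by blast
  then have "x \<in> I +> y" using I.a_rcos_self[OF assms(4)] by simp
  then obtain i where "i \<in> I" "x = i \<oplus> y" by (auto simp: a_r_coset_def')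
  then show ?thesis using assms(3) y by blast
qed

section \<open>The composite quotient map from the tensor algebra\<close>

context
  fixes p :: nat and M :: "'a matroid"
begin

lemma mod_ideal: "ideal (mod_ideal p M) (orlik_solomon M)"
proof -
  interpret ring "orlik_solomon M" by (rule ring_orlik_solomon)
  show ?thesis unfolding mod_ideal_def by (intro genideal_ideal) simp
qed

lemma exterior_class_hom:
  "ring_hom_ring (tensor_algebra (ground M)) (exterior_algebra (ground M)) (exterior_class (ground M))"
  unfolding exterior_algebra_def exterior_class_def[abs_def] by (rule ideal.rcos_ring_hom_ring[OF exterior_ideal])

lemma os_class_hom: "ring_hom_ring (tensor_algebra (ground M)) (orlik_solomon M) (os_class M)"
proof -
  have "(+>\<^bsub>exterior_algebra (ground M)\<^esub>) (os_ideal M) \<circ> exterior_class (ground M) \<in>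
     Ring.ring_hom (tensor_algebra (ground M)) (orlik_solomon M)"
    unfolding orlik_solomon_def
    by (rule ring_hom_trans[OF ring_hom_ring.homh[OF exterior_class_hom] ideal.rcos_ring_hom[OF os_ideal]])
  then show ?thesis
    by (intro ring_hom_ringI2 ring_tensor_algebra ring_orlik_solomon) (simp add: os_class_def[abs_def] comp_def)
qed

lemma os_mod_class_hom: "ring_hom_ring (tensor_algebra (ground M)) (orlik_solomon_mod p M) (os_mod_class p M)"
proof -
  have "(+>\<^bsub>orlik_solomon M\<^esub>) (mod_ideal p M) \<circ> os_class M \<in>
     Ring.ring_hom (tensor_algebra (ground M)) (orlik_solomon_mod p M)"
    unfolding orlik_solomon_mod_def
    by (rule ring_hom_trans[OF ring_hom_ring.homh[OF os_class_hom] ideal.rcos_ring_hom[OF mod_ideal]])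
  then show ?thesis
    by (intro ring_hom_ringI2 ring_tensor_algebra ring_orlik_solomon_mod) (simp add: os_mod_class_def[abs_def] comp_def)
qed

text \<open>Bounds the kernel of the threefold quotient map from above. \<open>J\<close> is pushed
  through the quotients one at a time; by minimality each generated ideal lies in the current image
  of \<open>J\<close>, and membership of \<open>x\<close> is then lifted back step by step.\<close>

lemma os_mod_class_eq_0D:
  assumes J: "ideal J (tensor_algebra (ground M))"
    and squares: "\<And>x. x \<in> tensor_degree (ground M) 1 \<Longrightarrow> x * x \<in> J"
    and circuits: "\<And>us. distinct us \<Longrightarrow> circuit M (set us) \<Longrightarrow> boundary us \<in> J"
    and p: "of_nat p \<in> J"
    and x: "x \<in> carrier (tensor_algebra (ground M))" "os_mod_class p M x = \<zero>\<^bsub>orlik_solomon_mod p M\<^esub>"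
  shows "x \<in> J"
proof -
  interpret T: ring "tensor_algebra (ground M)" by (rule ring_tensor_algebra)
  interpret E: ring "exterior_algebra (ground M)" by (rule ring_exterior_algebra)
  interpret O: ring "orlik_solomon M" by (rule ring_orlik_solomon)
  interpret e: ring_hom_ring "tensor_algebra (ground M)" "exterior_algebra (ground M)" "exterior_class (ground M)"
    by (rule exterior_class_hom)
  interpret o: ring_hom_ring "tensor_algebra (ground M)" "orlik_solomon M" "os_class M"
    by (rule os_class_hom)
  let ?J1 = "exterior_class (ground M) ` J"
  let ?J2 = "(\<lambda>y. os_ideal M +>\<^bsub>exterior_algebra (ground M)\<^esub> y) ` ?J1"
  have I0: "exterior_ideal (ground M) \<subseteq> J"
    unfolding exterior_ideal_def by (rule T.genideal_minimal[OF J]) (use squares in blast)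
  have J1: "ideal ?J1 (exterior_algebra (ground M))"
    using T.ring_ideal_imp_quot_ideal[OF exterior_ideal J]
    unfolding exterior_algebra_def exterior_class_def[abs_def] .
  have I1: "os_ideal M \<subseteq> ?J1"
    unfolding os_ideal_def by (rule E.genideal_minimal[OF J1]) (use circuits in blast)
  have J2: "ideal ?J2 (orlik_solomon M)"
    using E.ring_ideal_imp_quot_ideal[OF os_ideal J1] unfolding orlik_solomon_def .
  have "[p] \<cdot>\<^bsub>orlik_solomon M\<^esub> \<one>\<^bsub>orlik_solomon M\<^esub> = os_class M (of_nat p)"
    using o.hom_int_pow[of 1 "int p", OF tensor_algebra_closed(2)] o.hom_one
    by (simp add: tensor_algebra_add_pow add_pow_int_ge)
  also have "\<dots> \<in> ?J2" unfolding os_class_def using p by blast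
  finally have I2: "mod_ideal p M \<subseteq> ?J2"
    unfolding mod_ideal_def by (intro O.genideal_minimal[OF J2]) blast
  have "mod_ideal p M +>\<^bsub>orlik_solomon M\<^esub> os_class M x = mod_ideal p M"
    using x(2) by (simp add: orlik_solomon_mod_def FactRing_def os_mod_class_def)
  then have "os_class M x \<in> mod_ideal p M"
    using ideal.rcos_const_imp_mem[OF mod_ideal] x(1) o.hom_closed by blast
  then have "os_class M x \<in> ?J2" using I2 by blast
  then have "exterior_class (ground M) x \<in> ?J1"
    using E.mem_if_coset_mem[OF os_ideal J1 I1 e.hom_closed[OF x(1)]] unfolding os_class_def by blast
  then show ?thesis
    using T.mem_if_coset_mem[OF exterior_ideal J I0 x(1)] unfolding exterior_class_def[abs_def] by blast
qed

end

section \<open>Coefficients in degrees zero and one\<close>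

lemma plus_free_monoid_eq_Nil: "l + q = Letters [] \<longleftrightarrow> l = Letters [] \<and> q = Letters []"
  by (cases l; cases q) simp

lemma plus_free_monoid_eq_single:
  "l + q = Letters [u] \<longleftrightarrow> l = Letters [] \<and> q = Letters [u] \<or> l = Letters [u] \<and> q = Letters []"
  by (cases l; cases q) (auto simp: append_eq_Cons_conv)

lemma lookup_mult_Nil:
  "Poly_Mapping.lookup (f * g) (Letters []) = Poly_Mapping.lookup f (Letters []) * Poly_Mapping.lookup (g :: 'a free_monoid \<Rightarrow>\<^sub>0 int) (Letters [])"
proof -
  have "Poly_Mapping.lookup f l * (\<Sum>q. Poly_Mapping.lookup g q when Letters [] = l + q) =
     (Poly_Mapping.lookup f l * Poly_Mapping.lookup g (Letters []) when l = Letters [])" for l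
  proof -
    have eq: "(\<lambda>q. Poly_Mapping.lookup g q when Letters [] = l + q) =
        (\<lambda>q. (Poly_Mapping.lookup g q when l = Letters []) when q = Letters [])"
      by (rule ext) (auto simp: when_def eq_commute[of "Letters []"] plus_free_monoid_eq_Nil)
    show ?thesis by (simp only: eq Sum_any_when_equal) (simp add: when_def)
  qed
  then show ?thesis by (simp add: lookup_mult)
qed

text \<open>A one-letter word splits only with an empty factor on one side, so the linear
  coefficients obey the Leibniz rule.\<close>

lemma lookup_mult_single:
  "Poly_Mapping.lookup (f * g) (Letters [u]) =
     Poly_Mapping.lookup f (Letters []) * Poly_Mapping.lookup g (Letters [u])
   + Poly_Mapping.lookup f (Letters [u]) * Poly_Mapping.lookup (g :: 'a free_monoid \<Rightarrow>\<^sub>0 int) (Letters [])"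
proof -
  have "Poly_Mapping.lookup f l * (\<Sum>q. Poly_Mapping.lookup g q when Letters [u] = l + q) =
     (Poly_Mapping.lookup f l * Poly_Mapping.lookup g (Letters [u]) when l = Letters []) +
     (Poly_Mapping.lookup f l * Poly_Mapping.lookup g (Letters []) when l = Letters [u])" for l
  proof -
    consider "l = Letters []" | "l = Letters [u]" | "l \<noteq> Letters []" "l \<noteq> Letters [u]" by blast
    then show ?thesis
    proof cases
      case 1
      then have "(\<lambda>q. Poly_Mapping.lookup g q when Letters [u] = l + q) = (\<lambda>q. Poly_Mapping.lookup g q when q = Letters [u])"
        by (intro ext) (auto simp: when_def eq_commute[of "Letters [u]"] plus_free_monoid_eq_single)
      then have "(\<Sum>q. Poly_Mapping.lookup g q when Letters [u] = l + q) = Poly_Mapping.lookup g (Letters [u])"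
        by (simp only: Sum_any_when_equal)
      then show ?thesis using 1 by (simp only: when_def) simp
    next
      case 2
      then have "(\<lambda>q. Poly_Mapping.lookup g q when Letters [u] = l + q) = (\<lambda>q. Poly_Mapping.lookup g q when q = Letters [])"
        by (intro ext) (auto simp: when_def eq_commute[of "Letters [u]"] plus_free_monoid_eq_single)
      then have "(\<Sum>q. Poly_Mapping.lookup g q when Letters [u] = l + q) = Poly_Mapping.lookup g (Letters [])"
        by (simp only: Sum_any_when_equal)
      then show ?thesis using 2 by (simp only: when_def) simp
    next
      case 3
      then have "(\<lambda>q. Poly_Mapping.lookup g q when Letters [u] = l + q) = (\<lambda>q. 0)"
        by (intro ext) (auto simp: when_def eq_commute[of "Letters [u]"] plus_free_monoid_eq_single)
      then have "(\<Sum>q. Poly_Mapping.lookup g q when Letters [u] = l + q) = Sum_any (\<lambda>q :: 'a free_monoid. 0)"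
        by (rule arg_cong[where f = Sum_any])
      then show ?thesis using 3 by (simp only: when_def) simp
    qed
  qed
  then have "Poly_Mapping.lookup (f * g) (Letters [u]) =
     (\<Sum>l. (Poly_Mapping.lookup f l * Poly_Mapping.lookup g (Letters [u]) when l = Letters []) +
     (Poly_Mapping.lookup f l * Poly_Mapping.lookup g (Letters []) when l = Letters [u]))"
    by (simp add: lookup_mult)
  also have "\<dots> = (\<Sum>l. Poly_Mapping.lookup f l * Poly_Mapping.lookup g (Letters [u]) when l = Letters []) +
     (\<Sum>l. Poly_Mapping.lookup f l * Poly_Mapping.lookup g (Letters []) when l = Letters [u])"
    by (rule Sum_any.distrib) simp_all
  finally show ?thesis by simp
qed

text \<open>The test ideal for \<open>os_mod_class_eq_0D\<close>: it contains all defining relations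
  modulo \<open>p\<close> and still detects scalars and degree-one elements.\<close>

definition low_degree_ideal :: "nat \<Rightarrow> 'a set \<Rightarrow> ('a free_monoid \<Rightarrow>\<^sub>0 int) set" where
  "low_degree_ideal p V = {f \<in> carrier (tensor_algebra V). int p dvd Poly_Mapping.lookup f (Letters []) \<and>
     (\<forall>u. int p dvd Poly_Mapping.lookup f (Letters [u]))}"

lemma low_degree_ideal: "ideal (low_degree_ideal p V) (tensor_algebra V)"
proof (rule idealI[OF ring_tensor_algebra])
  interpret ring "tensor_algebra V" by (rule ring_tensor_algebra)
  show "subgroup (low_degree_ideal p V) (add_monoid (tensor_algebra V))"
  proof (rule add.subgroupI)
    show "low_degree_ideal p V \<subseteq> carrier (tensor_algebra V)" by (auto simp: low_degree_ideal_def)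
    have "0 \<in> low_degree_ideal p V" by (simp add: low_degree_ideal_def tensor_algebra_closed)
    then show "low_degree_ideal p V \<noteq> {}" by blast
  next
    fix a assume "a \<in> low_degree_ideal p V"
    then show "\<ominus>\<^bsub>tensor_algebra V\<^esub> a \<in> low_degree_ideal p V"
      by (simp add: low_degree_ideal_def tensor_algebra_minus tensor_algebra_closed)
  next
    fix a b assume "a \<in> low_degree_ideal p V" "b \<in> low_degree_ideal p V"
    then show "a \<oplus>\<^bsub>tensor_algebra V\<^esub> b \<in> low_degree_ideal p V"
      by (simp add: low_degree_ideal_def tensor_algebra_closed lookup_add)
  qed
next
  fix a x assume "a \<in> low_degree_ideal p V" "x \<in> carrier (tensor_algebra V)"
  then show "x \<otimes>\<^bsub>tensor_algebra V\<^esub> a \<in> low_degree_ideal p V" "a \<otimes>\<^bsub>tensor_algebra V\<^esub> x \<in> low_degree_ideal p V"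
    by (simp_all add: low_degree_ideal_def tensor_algebra_closed lookup_mult_Nil lookup_mult_single)
qed

text \<open>The boundary lowers the degree by one. The form with \<open>Suc\<close> also fits the
  empty list, whose boundary has no keys.\<close>

lemma keys_boundary: "Poly_Mapping.keys (boundary us) \<subseteq> {Letters vs | vs. Suc (length vs) = length us}"
proof (induction us)
  case (Cons u us)
  have "Poly_Mapping.keys (word [u] * boundary us) \<subseteq> {Letters vs | vs. length vs = length us}"
  proof
    fix k assume "k \<in> Poly_Mapping.keys (word [u] * boundary us)"
    then have "k \<in> {a + b | a b. a \<in> Poly_Mapping.keys (word [u]) \<and> b \<in> Poly_Mapping.keys (boundary us)}"
      by (rule subsetD[OF keys_mult])
    then obtain b where b: "k = Letters [u] + b" "b \<in> Poly_Mapping.keys (boundary us)"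
      by (auto simp: word_def)
    then obtain vs where "b = Letters vs" "Suc (length vs) = length us" using Cons.IH by blast
    then show "k \<in> {Letters vs | vs. length vs = length us}" using b by simp
  qed
  moreover have "Poly_Mapping.keys (word us) \<subseteq> {Letters vs | vs. length vs = length us}"
    by (auto simp: word_def)
  ultimately have "Poly_Mapping.keys (word us - word [u] * boundary us) \<subseteq> {Letters vs | vs. length vs = length us}"
    by (intro order_trans[OF keys_diff] Un_least)
  then show ?case by simp
qed simp

lemma circuit_card:
  assumes "simple_matroid M" "circuit M C" shows "card C \<ge> 3"
proof (rule ccontr)
  assume "\<not> 3 \<le> card C"
  then show False using assms by (auto simp: simple_matroid_def circuit_def)
qed

text \<open>Circuits of a simple matroid have at least three elements, so their boundaries live in
  degree at least 2.\<close>

lemma boundary_low_degree: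
  assumes "simple_matroid M" "distinct us" "circuit M (set us)"
  shows "boundary us \<in> low_degree_ideal p (ground M)"
proof -
  have "length us \<ge> 3" using circuit_card[OF assms(1,3)] assms(2) by (simp add: distinct_card)
  then have "Letters [] \<notin> Poly_Mapping.keys (boundary us)" "Letters [u] \<notin> Poly_Mapping.keys (boundary us)" for u
    using keys_boundary[of us] by auto
  then show ?thesis using assms(3) boundary_closed[of us "ground M"]
    by (simp add: low_degree_ideal_def circuit_def in_keys_iff)
qed

lemma tensor_degree_closed: "x \<in> tensor_degree V d \<Longrightarrow> x \<in> carrier (tensor_algebra V)"
  unfolding tensor_degree_def tensor_algebra_def by (simp, blast)

text \<open>Squares and circuit boundaries have no terms below degree 2, so in degrees 0 and 1 the
  only relation is reduction modulo \<open>p\<close>.\<close>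

lemma os_mod_class_eq_0_low_degree:
  assumes "simple_matroid M" "x \<in> carrier (tensor_algebra (ground M))"
    "os_mod_class p M x = \<zero>\<^bsub>orlik_solomon_mod p M\<^esub>"
  shows "int p dvd Poly_Mapping.lookup x (Letters [])" "int p dvd Poly_Mapping.lookup x (Letters [u])"
proof -
  have "x \<in> low_degree_ideal p (ground M)"
  proof (rule os_mod_class_eq_0D[OF low_degree_ideal _ _ _ assms(2,3)])
    fix y :: "'a free_monoid \<Rightarrow>\<^sub>0 int" assume y: "y \<in> tensor_degree (ground M) 1"
    then have "Letters [] \<notin> Poly_Mapping.keys y" by (auto simp: tensor_degree_def)
    then show "y * y \<in> low_degree_ideal p (ground M)"
      using tensor_degree_closed[OF y]
      by (simp add: low_degree_ideal_def tensor_algebra_closed lookup_mult_Nil lookup_mult_single in_keys_iff)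
  next
    have "Poly_Mapping.lookup (of_nat n :: 'a free_monoid \<Rightarrow>\<^sub>0 int) (Letters []) = int n"
      "Poly_Mapping.lookup (of_nat n :: 'a free_monoid \<Rightarrow>\<^sub>0 int) (Letters [v]) = 0" for v n
      by (simp_all add: lookup_of_nat zero_free_monoid_def when_def)
    then show "of_nat p \<in> low_degree_ideal p (ground M)"
      using tensor_algebra_of_int_closed[of "int p"] by (simp add: low_degree_ideal_def)
  qed (use boundary_low_degree assms(1) in blast)
  then show "int p dvd Poly_Mapping.lookup x (Letters [])" "int p dvd Poly_Mapping.lookup x (Letters [u])"
    by (simp_all add: low_degree_ideal_def)
qed

lemma lookup_of_int_Letters:
  "Poly_Mapping.lookup (of_int n :: 'a free_monoid \<Rightarrow>\<^sub>0 int) (Letters us) = (if us = [] then n else 0)"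
  by (cases n rule: int_cases2) (simp_all add: lookup_of_nat zero_free_monoid_def when_def)

lemma tensor_degree_add: "x \<in> tensor_degree V d \<Longrightarrow> y \<in> tensor_degree V d \<Longrightarrow> x + y \<in> tensor_degree V d"
  unfolding tensor_degree_def mem_Collect_eq by (rule order_trans[OF Poly_Mapping.keys_add Un_least])

lemma tensor_degree_of_int_mult: "x \<in> tensor_degree V d \<Longrightarrow> of_int n * x \<in> tensor_degree V d"
proof -
  assume x: "x \<in> tensor_degree V d"
  have 0: "0 \<in> tensor_degree V d" by (simp add: tensor_degree_def)
  have m: "- y \<in> tensor_degree V d" if "y \<in> tensor_degree V d" for y
    using that by (simp add: tensor_degree_def)
  have nat: "of_nat k * x \<in> tensor_degree V d" for k
    by (induction k) (use x 0 in \<open>simp_all add: distrib_right tensor_degree_add\<close>)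
  show ?thesis by (cases n rule: int_cases2) (use nat m in simp_all)
qed

lemma tensor_degree_1_expand:
  assumes "finite V" "x \<in> tensor_degree V 1"
  shows "x = (\<Sum>u\<in>V. of_int (Poly_Mapping.lookup x (Letters [u])) * word [u])"
proof (rule poly_mapping_eqI)
  fix k
  have s: "of_int n * word us = Poly_Mapping.single (Letters us) n" for n and us :: "'c list"
    unfolding word_def by (simp flip: single_of_int) (simp add: mult_single)
  have "Poly_Mapping.lookup (\<Sum>u\<in>V. of_int (Poly_Mapping.lookup x (Letters [u])) * word [u]) k
    = (\<Sum>u\<in>V. (Poly_Mapping.lookup x (Letters [u]) when Letters [u] = k))"
    by (simp add: s lookup_sum lookup_single)
  also have "\<dots> = Poly_Mapping.lookup x k"
  proof (cases "k \<in> Poly_Mapping.keys x")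
    case True
    then obtain us where "k = Letters us" "set us \<subseteq> V" "length us = 1" using assms(2) by (auto simp: tensor_degree_def)
    then obtain v where "k = Letters [v]" "v \<in> V" by (auto simp: length_Suc_conv)
    then show ?thesis using assms(1) by (simp add: when_def)
  next
    case False
    then have "(Poly_Mapping.lookup x (Letters [u]) when Letters [u] = k) = 0" for u
      by (auto simp: when_def in_keys_iff)
    then show ?thesis using False by (simp add: in_keys_iff)
  qed
  finally show "Poly_Mapping.lookup x k = Poly_Mapping.lookup (\<Sum>u\<in>V. of_int (Poly_Mapping.lookup x (Letters [u])) * word [u]) k" ..
qed

section \<open>Kernel of the quotient map and the scalar field\<close>

context
  fixes p :: nat and M :: "'a matroid"
begin

interpretation h: ring_hom_ring "tensor_algebra (ground M)" "orlik_solomon_mod p M" "os_mod_class p M"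
  by (rule os_mod_class_hom)

lemma os_mod_scalars_eq: "os_mod_scalars p M = {os_mod_class p M (of_int n) | n. True}"
proof -
  have "[n] \<cdot>\<^bsub>orlik_solomon_mod p M\<^esub> \<one>\<^bsub>orlik_solomon_mod p M\<^esub> = os_mod_class p M (of_int n)" for n :: int
    using h.hom_int_pow[of 1 n, OF tensor_algebra_closed(2)] h.hom_one by (simp add: tensor_algebra_add_pow)
  then show ?thesis by (simp add: os_mod_scalars_def)
qed

lemma os_mod_class_mult:
  assumes "x \<in> carrier (tensor_algebra (ground M))" "y \<in> carrier (tensor_algebra (ground M))"
  shows "os_mod_class p M (x * y) = os_mod_class p M x \<otimes>\<^bsub>orlik_solomon_mod p M\<^esub> os_mod_class p M y"
  using h.hom_mult[OF assms] by simp

lemma os_mod_class_add: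
  assumes "x \<in> carrier (tensor_algebra (ground M))" "y \<in> carrier (tensor_algebra (ground M))"
  shows "os_mod_class p M (x + y) = os_mod_class p M x \<oplus>\<^bsub>orlik_solomon_mod p M\<^esub> os_mod_class p M y"
  using h.hom_add[OF assms] by simp

lemma os_mod_class_uminus:
  assumes "x \<in> carrier (tensor_algebra (ground M))"
  shows "os_mod_class p M (- x) = \<ominus>\<^bsub>orlik_solomon_mod p M\<^esub> os_mod_class p M x"
  using h.hom_a_inv[OF assms] by (simp add: tensor_algebra_minus[OF assms])

lemma os_mod_class_0: "os_mod_class p M 0 = \<zero>\<^bsub>orlik_solomon_mod p M\<^esub>"
  using h.hom_zero by simp

lemma os_mod_class_1: "os_mod_class p M 1 = \<one>\<^bsub>orlik_solomon_mod p M\<^esub>"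
  using h.hom_one by simp

text \<open>Relations are verified on representatives in the tensor algebra, with the ring
  operations of the type, instead of on nested cosets.\<close>

definition os_mod_kernel :: "('a free_monoid \<Rightarrow>\<^sub>0 int) set" where
  "os_mod_kernel = {x \<in> carrier (tensor_algebra (ground M)). os_mod_class p M x = \<zero>\<^bsub>orlik_solomon_mod p M\<^esub>}"

lemma kernel_0: "0 \<in> os_mod_kernel"
  by (simp add: os_mod_kernel_def os_mod_class_0 tensor_algebra_closed)

lemma kernel_add: "x \<in> os_mod_kernel \<Longrightarrow> y \<in> os_mod_kernel \<Longrightarrow> x + y \<in> os_mod_kernel"
  by (simp add: os_mod_kernel_def os_mod_class_add tensor_algebra_closed)

lemma kernel_uminus: "x \<in> os_mod_kernel \<Longrightarrow> - x \<in> os_mod_kernel"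
  by (simp add: os_mod_kernel_def os_mod_class_uminus tensor_algebra_closed)

lemma kernel_diff: "x \<in> os_mod_kernel \<Longrightarrow> y \<in> os_mod_kernel \<Longrightarrow> x - y \<in> os_mod_kernel"
  using kernel_add[OF _ kernel_uminus] by (metis diff_conv_add_uminus)

lemma kernel_sum: "(\<And>i. i \<in> I \<Longrightarrow> x i \<in> os_mod_kernel) \<Longrightarrow> sum x I \<in> os_mod_kernel"
  by (induction I rule: infinite_finite_induct) (simp_all add: kernel_0 kernel_add)

lemma kernel_mult:
  assumes "x \<in> os_mod_kernel" "y \<in> carrier (tensor_algebra (ground M))"
  shows "x * y \<in> os_mod_kernel" "y * x \<in> os_mod_kernel"
  using assms h.hom_closed[OF assms(2)] by (simp_all add: os_mod_kernel_def os_mod_class_mult tensor_algebra_closed)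

lemma kernel_of_nat: "of_nat p \<in> os_mod_kernel"
proof -
  interpret O: ring "orlik_solomon M" by (rule ring_orlik_solomon)
  interpret o: ring_hom_ring "tensor_algebra (ground M)" "orlik_solomon M" "os_class M"
    by (rule os_class_hom)
  interpret I: ideal "mod_ideal p M" "orlik_solomon M" by (rule mod_ideal)
  have "os_class M (of_nat p) = [p] \<cdot>\<^bsub>orlik_solomon M\<^esub> \<one>\<^bsub>orlik_solomon M\<^esub>"
    using o.hom_int_pow[of 1 "int p", OF tensor_algebra_closed(2)] o.hom_one
    by (simp add: tensor_algebra_add_pow add_pow_int_ge)
  also have "\<dots> \<in> mod_ideal p M"
    unfolding mod_ideal_def by (rule O.genideal_self') simp
  finally have "os_mod_class p M (of_nat p) = mod_ideal p M"
    unfolding os_mod_class_def by (rule I.a_rcos_const)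
  then show ?thesis
    by (simp add: os_mod_kernel_def tensor_algebra_of_nat_closed orlik_solomon_mod_def FactRing_def)
qed

lemma kernel_of_int:
  assumes "int p dvd n" "x \<in> carrier (tensor_algebra (ground M))" shows "of_int n * x \<in> os_mod_kernel"
proof -
  obtain d where "n = int p * d" using assms(1) by (elim dvdE)
  then have "of_int n * x = of_nat p * (of_int d * x)" by (simp add: mult.assoc)
  then show ?thesis
    using kernel_mult(1)[OF kernel_of_nat] assms(2) by (simp add: tensor_algebra_closed tensor_algebra_of_int_closed)
qed

lemma os_mod_class_eq:
  assumes "x \<in> carrier (tensor_algebra (ground M))" "y \<in> carrier (tensor_algebra (ground M))"
    "x - y \<in> os_mod_kernel"
  shows "os_mod_class p M x = os_mod_class p M y"
proof -
  have "os_mod_class p M x \<oplus>\<^bsub>orlik_solomon_mod p M\<^esub> \<ominus>\<^bsub>orlik_solomon_mod p M\<^esub> os_mod_class p M y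
      = os_mod_class p M (x + - y)"
    by (simp only: os_mod_class_add os_mod_class_uminus tensor_algebra_closed assms)
  also have "\<dots> = \<zero>\<^bsub>orlik_solomon_mod p M\<^esub>" using assms by (simp add: os_mod_kernel_def)
  finally show ?thesis
    using h.S.r_right_minus_eq[OF h.hom_closed[OF assms(1)] h.hom_closed[OF assms(2)]] by (simp add: a_minus_def)
qed

context
  assumes simple: "simple_matroid M" and prime: "prime p"
begin

lemma os_mod_class_of_int_eq_0_iff: "os_mod_class p M (of_int n) = \<zero>\<^bsub>orlik_solomon_mod p M\<^esub> \<longleftrightarrow> int p dvd n"
proof
  assume "os_mod_class p M (of_int n) = \<zero>\<^bsub>orlik_solomon_mod p M\<^esub>"
  then have "int p dvd Poly_Mapping.lookup (of_int n :: 'a free_monoid \<Rightarrow>\<^sub>0 int) (Letters [])"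
    by (rule os_mod_class_eq_0_low_degree(1)[OF simple tensor_algebra_of_int_closed])
  then show "int p dvd n" by (simp add: lookup_of_int_Letters)
next
  assume "int p dvd n"
  then show "os_mod_class p M (of_int n) = \<zero>\<^bsub>orlik_solomon_mod p M\<^esub>"
    using kernel_of_int[of n 1] by (simp add: os_mod_kernel_def tensor_algebra_closed)
qed

text \<open>The scalars are classes of integers, and such a class vanishes exactly for multiples of
  \<open>p\<close>; hence they form a copy of the integers modulo a prime.\<close>

lemma os_mod_scalars_subfield: "subfield (os_mod_scalars p M) (orlik_solomon_mod p M)"
proof (rule h.S.subfieldI)
  let ?K = "os_mod_scalars p M" and ?R = "orlik_solomon_mod p M"
  note c = tensor_algebra_of_int_closed[of _ "ground M"]
  have elem: "os_mod_class p M (of_int n) \<in> ?K" for n by (auto simp: os_mod_scalars_eq)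
  have mult: "os_mod_class p M (of_int n) \<otimes>\<^bsub>?R\<^esub> os_mod_class p M (of_int k) = os_mod_class p M (of_int (n * k))" for n k
    using os_mod_class_mult[OF c c, of n k] by simp
  have add: "os_mod_class p M (of_int n) \<oplus>\<^bsub>?R\<^esub> os_mod_class p M (of_int k) = os_mod_class p M (of_int (n + k))" for n k
    using os_mod_class_add[OF c c, of n k] by simp
  have neg: "\<ominus>\<^bsub>?R\<^esub> os_mod_class p M (of_int n) = os_mod_class p M (of_int (- n))" for n
    using os_mod_class_uminus[OF c, of n] by simp
  have one: "\<one>\<^bsub>?R\<^esub> = os_mod_class p M (of_int 1)" using os_mod_class_1 by simp
  have ne: "\<one>\<^bsub>?R\<^esub> \<noteq> \<zero>\<^bsub>?R\<^esub>"
    unfolding one os_mod_class_of_int_eq_0_iff using prime prime_gt_1_nat by fastforce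
  show "subcring ?K ?R"
  proof (rule subcring.intro)
    show "subring ?K ?R"
    proof (rule h.S.subringI)
      show "?K \<subseteq> carrier ?R" using h.hom_closed[OF c] by (auto simp: os_mod_scalars_eq)
      show "\<one>\<^bsub>?R\<^esub> \<in> ?K" unfolding one by (rule elem)
    next
      fix a assume "a \<in> ?K"
      then obtain n where "a = os_mod_class p M (of_int n)" by (auto simp: os_mod_scalars_eq)
      then show "\<ominus>\<^bsub>?R\<^esub> a \<in> ?K" by (simp only: neg elem)
    next
      fix a b assume "a \<in> ?K" "b \<in> ?K"
      then obtain n k where "a = os_mod_class p M (of_int n)" "b = os_mod_class p M (of_int k)"
        by (auto simp: os_mod_scalars_eq)
      then show "a \<otimes>\<^bsub>?R\<^esub> b \<in> ?K" "a \<oplus>\<^bsub>?R\<^esub> b \<in> ?K" by (simp_all only: mult add elem)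
    qed
    have "a \<otimes>\<^bsub>?R\<^esub> b = b \<otimes>\<^bsub>?R\<^esub> a" if "a \<in> ?K" "b \<in> ?K" for a b
    proof -
      from that obtain n k where "a = os_mod_class p M (of_int n)" "b = os_mod_class p M (of_int k)"
        by (auto simp: os_mod_scalars_eq)
      then show ?thesis by (simp only: mult mult.commute)
    qed
    then show "subcring_axioms ?K ?R" unfolding subcring_axioms_def by blast
  qed
  show "Units (?R\<lparr>carrier := ?K\<rparr>) = ?K - {\<zero>\<^bsub>?R\<^esub>}"
  proof (intro subset_antisym subsetI)
    fix k assume k: "k \<in> Units (?R\<lparr>carrier := ?K\<rparr>)"
    then obtain k' where k': "k \<in> ?K" "k' \<in> ?K" "k \<otimes>\<^bsub>?R\<^esub> k' = \<one>\<^bsub>?R\<^esub>" by (auto simp: Units_def)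
    moreover have "k' \<in> carrier ?R" using k'(2) h.hom_closed[OF c] by (auto simp: os_mod_scalars_eq)
    ultimately show "k \<in> ?K - {\<zero>\<^bsub>?R\<^esub>}" using ne h.S.l_null[of k'] by (metis Diff_iff singletonD)
  next
    fix k assume k: "k \<in> ?K - {\<zero>\<^bsub>?R\<^esub>}"
    then obtain n where n: "k = os_mod_class p M (of_int n)" by (auto simp: os_mod_scalars_eq)
    then have "\<not> int p dvd n" using k by (simp add: os_mod_class_of_int_eq_0_iff)
    then have "coprime (int p) n" using prime by (intro prime_imp_coprime) auto
    \<comment> \<open>A Bezout coefficient represents the inverse.\<close>
    then obtain u v where uv: "u * int p + v * n = 1" using bezout_int[of "int p" n] by (metis coprime_iff_gcd_eq_1)
    have "of_int (v * n) - of_int 1 \<in> os_mod_kernel"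
    proof -
      have "v * n - 1 = int p * (- u)" using uv by (simp add: algebra_simps)
      then have "of_int (v * n - 1) * 1 \<in> os_mod_kernel" by (intro kernel_of_int) (auto simp: tensor_algebra_closed)
      then show ?thesis by simp
    qed
    then have "os_mod_class p M (of_int (v * n)) = \<one>\<^bsub>?R\<^esub>"
      unfolding one by (intro os_mod_class_eq c)
    then have "os_mod_class p M (of_int v) \<otimes>\<^bsub>?R\<^esub> k = \<one>\<^bsub>?R\<^esub>" "k \<otimes>\<^bsub>?R\<^esub> os_mod_class p M (of_int v) = \<one>\<^bsub>?R\<^esub>"
      unfolding n by (simp_all only: mult mult.commute)
    then show "k \<in> Units (?R\<lparr>carrier := ?K\<rparr>)"
      using elem[of v] elem[of n] unfolding Units_def n by auto
  qed
qed

end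

end

section \<open>Cocycles of degree one\<close>

lemma tensor_degree_0: "0 \<in> tensor_degree V d"
  by (simp add: tensor_degree_def)

lemma tensor_degree_sum: "(\<And>i. i \<in> I \<Longrightarrow> x i \<in> tensor_degree V d) \<Longrightarrow> sum x I \<in> tensor_degree V d"
  by (induction I rule: infinite_finite_induct) (simp_all add: tensor_degree_0 tensor_degree_add)

lemma word_tensor_degree: "u \<in> V \<Longrightarrow> word [u] \<in> tensor_degree V 1"
  by (auto simp: tensor_degree_def word_def)

text \<open>The space whose dimension minus one is \<open>aomoto_betti\<close>.\<close>

definition cocycles :: "nat \<Rightarrow> 'a matroid \<Rightarrow> ('a free_monoid \<Rightarrow>\<^sub>0 int) set set set set" where
  "cocycles p M = {\<tau> \<in> os_mod_degree p M 1.
        os_mod_sigma p M \<otimes>\<^bsub>orlik_solomon_mod p M\<^esub> \<tau> = \<zero>\<^bsub>orlik_solomon_mod p M\<^esub>}"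

context
  fixes p :: nat and M :: "'a matroid"
  assumes simple: "simple_matroid M" and prime: "prime p"
begin

interpretation h: ring_hom_ring "tensor_algebra (ground M)" "orlik_solomon_mod p M" "os_mod_class p M"
  by (rule os_mod_class_hom)

lemma sigma_closed: "(\<Sum>u\<in>ground M. word [u]) \<in> carrier (tensor_algebra (ground M))"
  by (rule tensor_algebra_sum_closed) (rule word_closed, simp)

lemma cocycles_eq:
  "cocycles p M = {os_mod_class p M x | x. x \<in> tensor_degree (ground M) 1 \<and> (\<Sum>u\<in>ground M. word [u]) * x \<in> os_mod_kernel p M}"
proof -
  have "os_mod_sigma p M \<otimes>\<^bsub>orlik_solomon_mod p M\<^esub> os_mod_class p M x = \<zero>\<^bsub>orlik_solomon_mod p M\<^esub> \<longleftrightarrow>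
     (\<Sum>u\<in>ground M. word [u]) * x \<in> os_mod_kernel p M" if "x \<in> tensor_degree (ground M) 1" for x
    using tensor_degree_closed[OF that] sigma_closed
    by (simp add: os_mod_kernel_def os_mod_class_mult os_mod_sigma_def tensor_algebra_closed)
  then show ?thesis unfolding cocycles_def os_mod_degree_def by blast
qed

text \<open>Here \<open>subalgebra\<close> means a linear subspace: an additive subgroup closed
  under multiplication by scalars.\<close>

lemma cocycles_subalgebra: "subalgebra (os_mod_scalars p M) (cocycles p M) (orlik_solomon_mod p M)"
proof -
  let ?R = "orlik_solomon_mod p M"
  have add: "a \<oplus>\<^bsub>?R\<^esub> b \<in> cocycles p M" if "a \<in> cocycles p M" "b \<in> cocycles p M" for a b
  proof -
    from that obtain x y where xy: "a = os_mod_class p M x" "b = os_mod_class p M y"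
      "x \<in> tensor_degree (ground M) 1" "y \<in> tensor_degree (ground M) 1"
      "(\<Sum>u\<in>ground M. word [u]) * x \<in> os_mod_kernel p M" "(\<Sum>u\<in>ground M. word [u]) * y \<in> os_mod_kernel p M"
      by (auto simp: cocycles_eq)
    have "a \<oplus>\<^bsub>?R\<^esub> b = os_mod_class p M (x + y)"
      using xy by (simp add: os_mod_class_add tensor_degree_closed)
    moreover have "(\<Sum>u\<in>ground M. word [u]) * (x + y) \<in> os_mod_kernel p M"
      using kernel_add[OF xy(5,6)] by (simp add: distrib_left)
    ultimately show ?thesis using tensor_degree_add[OF xy(3,4)] unfolding cocycles_eq by blast
  qed
  have smult: "k \<otimes>\<^bsub>?R\<^esub> a \<in> cocycles p M" if "k \<in> os_mod_scalars p M" "a \<in> cocycles p M" for k a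
  proof -
    from that obtain n x where x: "k = os_mod_class p M (of_int n)" "a = os_mod_class p M x"
      "x \<in> tensor_degree (ground M) 1" "(\<Sum>u\<in>ground M. word [u]) * x \<in> os_mod_kernel p M"
      by (auto simp: cocycles_eq os_mod_scalars_eq)
    have "k \<otimes>\<^bsub>?R\<^esub> a = os_mod_class p M (of_int n * x)"
      using x by (simp add: os_mod_class_mult tensor_degree_closed tensor_algebra_of_int_closed)
    \<comment> \<open>Integers are central, so the scalar moves past sigma.\<close>
    moreover have "(\<Sum>u\<in>ground M. word [u]) * (of_int n * x) = of_int n * ((\<Sum>u\<in>ground M. word [u]) * x)"
      by (metis mult.assoc mult_of_int_commute)
    then have "(\<Sum>u\<in>ground M. word [u]) * (of_int n * x) \<in> os_mod_kernel p M"
      using kernel_mult(2)[OF x(4) tensor_algebra_of_int_closed, of n] by simp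
    ultimately show ?thesis using tensor_degree_of_int_mult[OF x(3)] unfolding cocycles_eq by blast
  qed
  have closed: "cocycles p M \<subseteq> carrier ?R"
    using h.hom_closed[OF tensor_degree_closed] by (auto simp: cocycles_eq)
  show ?thesis
  proof (intro subalgebra.intro subalgebra_axioms.intro h.S.add.subgroupI)
    have "0 \<in> tensor_degree (ground M) 1" "(\<Sum>u\<in>ground M. word [u]) * 0 \<in> os_mod_kernel p M"
      by (simp_all add: tensor_degree_0 kernel_0)
    then show "cocycles p M \<noteq> {}" unfolding cocycles_eq by blast
  next
    fix a assume a: "a \<in> cocycles p M"
    interpret K: subfield "os_mod_scalars p M" ?R by (rule os_mod_scalars_subfield[OF simple prime])
    have m: "\<ominus>\<^bsub>?R\<^esub> \<one>\<^bsub>?R\<^esub> \<in> os_mod_scalars p M"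
      using subringE(3,5)[OF K.subring_axioms] by blast
    have "\<ominus>\<^bsub>?R\<^esub> a = \<ominus>\<^bsub>?R\<^esub> \<one>\<^bsub>?R\<^esub> \<otimes>\<^bsub>?R\<^esub> a"
      using a closed h.S.l_minus[of "\<one>\<^bsub>?R\<^esub>" a] by auto
    then show "\<ominus>\<^bsub>?R\<^esub> a \<in> cocycles p M" using smult[OF m a] by simp
  qed (use add smult closed in auto)
qed

text \<open>Ensures that \<open>dim\<close> is a genuine dimension: the cocycles form a subspace of
  the span of the finitely many generator classes.\<close>

lemma cocycles_finite_dimension:
  assumes fin: "finite (ground M)"
  shows "ring.finite_dimension (orlik_solomon_mod p M) (os_mod_scalars p M) (cocycles p M)"
proof -
  let ?R = "orlik_solomon_mod p M" and ?K = "os_mod_scalars p M"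
  note K = os_mod_scalars_subfield[OF simple prime]
  obtain us where us: "set us = ground M" using finite_list[OF fin] by blast
  let ?Us = "map (\<lambda>u. os_mod_class p M (word [u])) us"
  have Us: "set ?Us \<subseteq> carrier ?R"
    using us h.hom_closed[OF word_closed] by auto
  have "cocycles p M \<subseteq> h.S.Span ?K ?Us"
  proof
    fix a assume "a \<in> cocycles p M"
    then obtain x where x: "a = os_mod_class p M x" "x \<in> tensor_degree (ground M) 1" by (auto simp: cocycles_eq)
    have "os_mod_class p M (\<Sum>u\<in>S. of_int (c u) * word [u]) \<in> h.S.Span ?K ?Us" if "S \<subseteq> ground M" for S c
      using finite_subset[OF that fin] that
    proof (induction S rule: finite_induct)
      case empty
      then show ?case using h.S.Span_subgroup_props(2)[OF K Us] by (simp add: os_mod_class_0)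
    next
      case (insert u S)
      have w: "word [v] \<in> carrier (tensor_algebra (ground M))" if "v \<in> ground M" for v
        using that by (simp add: word_closed)
      have 1: "os_mod_class p M (\<Sum>u\<in>insert u S. of_int (c u) * word [u]) =
         os_mod_class p M (of_int (c u)) \<otimes>\<^bsub>?R\<^esub> os_mod_class p M (word [u]) \<oplus>\<^bsub>?R\<^esub> os_mod_class p M (\<Sum>u\<in>S. of_int (c u) * word [u])"
      proof -
        have "of_int (c u) * word [u] \<in> carrier (tensor_algebra (ground M))"
          "(\<Sum>u\<in>S. of_int (c u) * word [u]) \<in> carrier (tensor_algebra (ground M))"
          using w insert.prems
          by (auto intro!: tensor_algebra_closed tensor_algebra_sum_closed tensor_algebra_of_int_closed)
        moreover have "word [u] \<in> carrier (tensor_algebra (ground M))" using w insert.prems by simp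
        ultimately show ?thesis
          unfolding sum.insert[OF insert(1,2)] by (simp add: os_mod_class_add os_mod_class_mult tensor_algebra_of_int_closed)
      qed
      have "os_mod_class p M (word [u]) \<in> h.S.Span ?K ?Us"
        by (rule subsetD[OF h.S.Span_base_incl[OF K Us]]) (use us insert.prems in auto)
      then have "os_mod_class p M (of_int (c u)) \<otimes>\<^bsub>?R\<^esub> os_mod_class p M (word [u]) \<in> h.S.Span ?K ?Us"
        by (intro h.S.Span_smult_closed[OF K Us]) (auto simp: os_mod_scalars_eq)
      then show ?case unfolding 1 using insert by (intro h.S.Span_subgroup_props(3)[OF K Us]) auto
    qed
    from this[OF order_refl, of "\<lambda>u. Poly_Mapping.lookup x (Letters [u])"] show "a \<in> h.S.Span ?K ?Us"
      unfolding x(1) by (simp only: tensor_degree_1_expand[OF fin x(2), symmetric])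
  qed
  then show ?thesis
    by (rule h.S.subalbegra_incl_imp_finite_dimension[OF K h.S.Span_finite_dimension[OF K Us] cocycles_subalgebra])
qed

text \<open>Closedness of the sum is carried along because the induction step needs it to split the
  class of a sum.\<close>

lemma combine_os_mod_class:
  assumes "\<And>i. i \<in> set is \<Longrightarrow> t i \<in> carrier (tensor_algebra (ground M))"
  shows "h.S.combine (map (\<lambda>i. os_mod_class p M (of_int (c i))) is) (map (\<lambda>i. os_mod_class p M (t i)) is)
     = os_mod_class p M (\<Sum>i\<leftarrow>is. of_int (c i) * t i)
   \<and> (\<Sum>i\<leftarrow>is. of_int (c i) * t i) \<in> carrier (tensor_algebra (ground M))"
  using assms
proof (induction "is")
  case (Cons i "is")
  then show ?case
    by (simp add: os_mod_class_add os_mod_class_mult tensor_algebra_closed tensor_algebra_of_int_closed)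
qed (simp add: os_mod_class_0 tensor_algebra_closed)

text \<open>Linear independence of degree-one classes can be tested on integer coefficients modulo
  \<open>p\<close>, by \<open>os_mod_class_eq_0_low_degree\<close>; independent cocycles then bound
  the dimension from below.\<close>

lemma aomoto_betti_ge:
  assumes fin: "finite (ground M)"
    and t: "\<And>i. i < n \<Longrightarrow> t i \<in> tensor_degree (ground M) 1"
      "\<And>i. i < n \<Longrightarrow> (\<Sum>u\<in>ground M. word [u]) * t i \<in> os_mod_kernel p M"
    and indep: "\<And>c i. (\<And>u. int p dvd (\<Sum>j<n. c j * Poly_Mapping.lookup (t j) (Letters [u]))) \<Longrightarrow> i < n \<Longrightarrow> int p dvd c i"
  shows "int n - 1 \<le> aomoto_betti p M"
proof -
  let ?R = "orlik_solomon_mod p M" and ?K = "os_mod_scalars p M"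
  note K = os_mod_scalars_subfield[OF simple prime]
  let ?Us = "map (\<lambda>i. os_mod_class p M (t i)) [0..<n]"
  have tc: "t i \<in> carrier (tensor_algebra (ground M))" if "i < n" for i
    using tensor_degree_closed t(1)[OF that] .
  have sub: "set ?Us \<subseteq> cocycles p M" using t by (auto simp: cocycles_eq)
  have "h.S.independent ?K ?Us"
  proof (rule ccontr)
    assume dep: "h.S.dependent ?K ?Us"
    have car: "set ?Us \<subseteq> carrier ?R" using tc h.hom_closed by auto
    obtain Ks where Ks: "length Ks = length ?Us" "h.S.combine Ks ?Us = \<zero>\<^bsub>?R\<^esub>" "set Ks \<subseteq> ?K" "set Ks \<noteq> {\<zero>\<^bsub>?R\<^esub>}"
      by (rule h.S.dependent_imp_non_trivial_combine[OF K car dep])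
    have "\<forall>i<n. \<exists>k. Ks ! i = os_mod_class p M (of_int k)"
    proof (intro allI impI)
      fix i assume "i < n"
      then have "Ks ! i \<in> ?K" using Ks(1,3) by (auto simp: subset_iff)
      then show "\<exists>k. Ks ! i = os_mod_class p M (of_int k)" by (auto simp: os_mod_scalars_eq)
    qed
    then obtain c where c: "\<And>i. i < n \<Longrightarrow> Ks ! i = os_mod_class p M (of_int (c i))" by metis
    have Ks': "Ks = map (\<lambda>i. os_mod_class p M (of_int (c i))) [0..<n]"
      by (rule nth_equalityI) (use Ks(1) c in auto)
    let ?x = "\<Sum>i\<leftarrow>[0..<n]. of_int (c i) * t i"
    have x: "?x \<in> carrier (tensor_algebra (ground M))" "os_mod_class p M ?x = \<zero>\<^bsub>?R\<^esub>"
      using combine_os_mod_class[of "[0..<n]" t c] tc Ks(2) unfolding Ks' by auto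
    have "int p dvd (\<Sum>j<n. c j * Poly_Mapping.lookup (t j) (Letters [u]))" for u
    proof -
      have "Poly_Mapping.lookup ?x (Letters [u]) = (\<Sum>j<n. c j * Poly_Mapping.lookup (t j) (Letters [u]))"
        by (simp add: sum_list_distinct_conv_sum_set lookup_sum lookup_mult_single lookup_of_int_Letters atLeast0LessThan)
      then show ?thesis using os_mod_class_eq_0_low_degree(2)[OF simple x, of u] by simp
    qed
    then have "int p dvd c i" if "i < n" for i using indep that by blast
    then have "set Ks \<subseteq> {\<zero>\<^bsub>?R\<^esub>}"
      unfolding Ks' by (simp add: image_subset_iff os_mod_class_of_int_eq_0_iff[OF simple prime])
    \<comment> \<open>The non-triviality condition \<open>set Ks \<noteq> {0}\<close> is also met by
      the empty list, so \<open>n = 0\<close> is excluded separately: the empty list is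
      independent.\<close>
    then have "set Ks = {}" using Ks(4) subset_singletonD by metis
    then have "n = 0" using Ks(1) by simp
    then show False using dep by simp
  qed
  moreover have "h.S.dimension (h.S.dim ?K (cocycles p M)) ?K (cocycles p M)"
    using h.S.finite_dimensionE[OF K cocycles_finite_dimension[OF fin]] by (simp add: over_def)
  ultimately have "length ?Us \<le> h.S.dim ?K (cocycles p M)"
    using h.S.independent_length_le_dimension[OF K] sub by blast
  then show ?thesis by (simp add: aomoto_betti_def cocycles_def)
qed

end

section \<open>Relations on lines\<close>

lemma word_Nil: "word [] = 1"
  by (simp add: word_def flip: zero_free_monoid_def)

lemma word_append: "word (us @ vs) = word us * word vs"
  by (simp add: word_def mult_single)

lemma word_singleton_closed: "u \<in> V \<Longrightarrow> word [u] \<in> carrier (tensor_algebra V)"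
  by (rule word_closed) simp

lemma boundary_three: "boundary [b, u, v] = word [u] * word [v] - word [b] * word [v] + word [b] * word [u]"
  using word_append[of "[u]" "[v]"] by (simp add: word_Nil algebra_simps)

text \<open>Anything that vanishes in the integral Orlik-Solomon algebra vanishes modulo
  \<open>p\<close>.\<close>

lemma kernel_if_exterior_class_mem:
  assumes "x \<in> carrier (tensor_algebra (ground M))" "exterior_class (ground M) x \<in> os_ideal M"
  shows "x \<in> os_mod_kernel p M"
proof -
  interpret I: ideal "os_ideal M" "exterior_algebra (ground M)" by (rule os_ideal)
  interpret P: ideal "mod_ideal p M" "orlik_solomon M" by (rule mod_ideal)
  have "os_class M x = \<zero>\<^bsub>orlik_solomon M\<^esub>"
    unfolding os_class_def I.a_rcos_const[OF assms(2)] by (simp add: orlik_solomon_def FactRing_def)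
  then have "os_mod_class p M x = mod_ideal p M"
    unfolding os_mod_class_def using P.a_rcos_const[OF additive_subgroup.zero_closed[OF P.is_additive_subgroup]] by simp
  then show ?thesis using assms(1) by (simp add: os_mod_kernel_def orlik_solomon_mod_def FactRing_def)
qed

lemma kernel_square:
  assumes x: "x \<in> tensor_degree (ground M) 1" shows "x * x \<in> os_mod_kernel p M"
proof (rule kernel_if_exterior_class_mem)
  interpret T: ring "tensor_algebra (ground M)" by (rule ring_tensor_algebra)
  interpret X: ideal "exterior_ideal (ground M)" "tensor_algebra (ground M)" by (rule exterior_ideal)
  interpret I: ideal "os_ideal M" "exterior_algebra (ground M)" by (rule os_ideal)
  have c: "{x * x | x. x \<in> tensor_degree (ground M) 1} \<subseteq> carrier (tensor_algebra (ground M))"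
    using tensor_degree_closed tensor_algebra_closed(4) by blast
  show "x * x \<in> carrier (tensor_algebra (ground M))" using c x by blast
  have "x * x \<in> exterior_ideal (ground M)"
    unfolding exterior_ideal_def by (rule subsetD[OF T.genideal_self[OF c]]) (use x in blast)
  then have "exterior_class (ground M) (x * x) = \<zero>\<^bsub>exterior_algebra (ground M)\<^esub>"
    unfolding exterior_class_def by (simp add: X.a_rcos_const exterior_algebra_def FactRing_def)
  then show "exterior_class (ground M) (x * x) \<in> os_ideal M" by simp
qed

lemma kernel_boundary:
  assumes us: "distinct us" "circuit M (set us)" shows "boundary us \<in> os_mod_kernel p M"
proof (rule kernel_if_exterior_class_mem)
  interpret E: ring "exterior_algebra (ground M)" by (rule ring_exterior_algebra)
  interpret e: ring_hom_ring "tensor_algebra (ground M)" "exterior_algebra (ground M)" "exterior_class (ground M)"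
    by (rule exterior_class_hom)
  have closed: "boundary vs \<in> carrier (tensor_algebra (ground M))" if "circuit M (set vs)" for vs
    using that by (intro boundary_closed) (simp add: circuit_def)
  then show "boundary us \<in> carrier (tensor_algebra (ground M))" using us by blast
  have "{exterior_class (ground M) (boundary us) | us. distinct us \<and> circuit M (set us)} \<subseteq> carrier (exterior_algebra (ground M))"
    using e.hom_closed[OF closed] by blast
  then show "exterior_class (ground M) (boundary us) \<in> os_ideal M"
    unfolding os_ideal_def by (rule subsetD[OF E.genideal_self]) (use us in blast)
qed

text \<open>Polarization of the square of a sum of two generators.\<close>

lemma kernel_anticommute:
  assumes "u \<in> ground M" "v \<in> ground M"
  shows "word [u] * word [v] + word [v] * word [u] \<in> os_mod_kernel p M"
proof -
  have u: "word [u] \<in> tensor_degree (ground M) 1" and v: "word [v] \<in> tensor_degree (ground M) 1"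
    by (rule word_tensor_degree[OF assms(1)], rule word_tensor_degree[OF assms(2)])
  have "word [u] * word [v] + word [v] * word [u]
     = (word [u] + word [v]) * (word [u] + word [v]) - word [u] * word [u] - word [v] * word [v]"
    by (simp add: algebra_simps)
  then show ?thesis
    using kernel_diff[OF kernel_diff[OF kernel_square[OF tensor_degree_add[OF u v]] kernel_square[OF u]] kernel_square[OF v]]
    by simp
qed

text \<open>Rewriting each product with the base point \<open>b\<close> splits the double sum into
  two parts, one with the factor \<open>card L\<close> and one with the factor
  \<open>\<Sum>v\<in>L. \<eta> v\<close>, both divisible by \<open>p\<close>.\<close>

lemma kernel_line:
  assumes L: "L \<subseteq> ground M" "finite L"
    and circ: "\<And>b u v. b \<in> L \<Longrightarrow> u \<in> L \<Longrightarrow> v \<in> L \<Longrightarrow> distinct [b, u, v] \<Longrightarrow> circuit M {b, u, v}"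
    and dvd: "int p dvd int (card L)" "int p dvd (\<Sum>v\<in>L. \<eta> v)"
  shows "(\<Sum>(u, v)\<in>L \<times> L. of_int (\<eta> v) * (word [u] * word [v])) \<in> os_mod_kernel p M"
proof (cases "L = {}")
  case True
  then show ?thesis by (simp add: kernel_0)
next
  case False
  then obtain b where b: "b \<in> L" by blast
  have w: "word [u] \<in> carrier (tensor_algebra (ground M))" if "u \<in> L" for u
    using that L(1) by (intro word_singleton_closed) blast
  have sq: "word [u] * word [u] \<in> os_mod_kernel p M" if "u \<in> L" for u
    using that L(1) by (intro kernel_square word_tensor_degree) blast
  \<comment> \<open>This is \<open>boundary [b, u, v]\<close>; when two of the three points coincide
    it is a combination of squares and anticommutators.\<close>
  define r where "r u v = word [u] * word [v] - word [b] * word [v] + word [b] * word [u]" for u v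
  have r: "r u v \<in> os_mod_kernel p M" if uv: "u \<in> L" "v \<in> L" for u v
  proof -
    consider "u = v" | "u = b" | "v = b" "u \<noteq> b" | "distinct [b, u, v]" by auto
    then show ?thesis
    proof cases
      case 1
      then show ?thesis using sq[OF uv(1)] by (simp add: r_def)
    next
      case 2
      then show ?thesis using sq[OF b] by (simp add: r_def)
    next
      case 3
      then have "r u v = word [u] * word [b] + word [b] * word [u] - word [b] * word [b]" by (simp add: r_def)
      then show ?thesis
        using kernel_diff[OF kernel_anticommute[of u M b] sq[OF b]] uv b L(1) by auto
    next
      case 4
      then show ?thesis
        using kernel_boundary[of "[b, u, v]" M] circ[OF b uv 4] unfolding r_def boundary_three by simp
    qed
  qed
  have "(\<Sum>(u, v)\<in>L \<times> L. of_int (\<eta> v) * (word [u] * word [v]))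
     = (\<Sum>(u, v)\<in>L \<times> L. of_int (\<eta> v) * r u v) + (\<Sum>(u, v)\<in>L \<times> L. of_int (\<eta> v) * (word [b] * word [v]))
       - (\<Sum>(u, v)\<in>L \<times> L. of_int (\<eta> v) * (word [b] * word [u]))"
    by (simp add: r_def case_prod_unfold algebra_simps flip: sum.distrib sum_subtractf)
  also have "(\<Sum>(u, v)\<in>L \<times> L. of_int (\<eta> v) * (word [b] * word [v]))
     = of_int (int (card L)) * (\<Sum>v\<in>L. of_int (\<eta> v) * (word [b] * word [v]))"
    by (simp flip: sum.cartesian_product)
  also have "(\<Sum>(u, v)\<in>L \<times> L. of_int (\<eta> v) * (word [b] * word [u]))
     = of_int (\<Sum>v\<in>L. \<eta> v) * (\<Sum>u\<in>L. word [b] * word [u])"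
    by (subst sum.swap[of _ L L, unfolded sum.cartesian_product]) (simp add: sum_product of_int_sum flip: sum.cartesian_product)
  finally have eq: "(\<Sum>(u, v)\<in>L \<times> L. of_int (\<eta> v) * (word [u] * word [v]))
     = (\<Sum>(u, v)\<in>L \<times> L. of_int (\<eta> v) * r u v) + of_int (int (card L)) * (\<Sum>v\<in>L. of_int (\<eta> v) * (word [b] * word [v]))
       - of_int (\<Sum>v\<in>L. \<eta> v) * (\<Sum>u\<in>L. word [b] * word [u])" .
  have "(\<Sum>(u, v)\<in>L \<times> L. of_int (\<eta> v) * r u v) \<in> os_mod_kernel p M"
    using r by (intro kernel_sum) (auto intro: kernel_mult(2) tensor_algebra_of_int_closed)
  moreover have "of_int (int (card L)) * (\<Sum>v\<in>L. of_int (\<eta> v) * (word [b] * word [v])) \<in> os_mod_kernel p M"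
    using w b by (intro kernel_of_int[OF dvd(1)] tensor_algebra_sum_closed tensor_algebra_closed tensor_algebra_of_int_closed) auto
  moreover have "of_int (\<Sum>v\<in>L. \<eta> v) * (\<Sum>u\<in>L. word [b] * word [u]) \<in> os_mod_kernel p M"
    using w b by (intro kernel_of_int[OF dvd(2)] tensor_algebra_sum_closed tensor_algebra_closed) auto
  ultimately show ?thesis unfolding eq by (intro kernel_add kernel_diff)
qed

text \<open>Two distinct points lie on exactly one line, so the off-diagonal pairs of the double sum
  are partitioned by lines. Diagonal terms are squares, which allows passing between full and
  off-diagonal sums.\<close>

lemma kernel_sigma_mult:
  fixes line :: "'a \<Rightarrow> 'a \<Rightarrow> 'a set"
  assumes fin: "finite (ground M)"
    and mem: "\<And>u v. u \<in> ground M \<Longrightarrow> v \<in> ground M \<Longrightarrow> u \<noteq> v \<Longrightarrow> u \<in> line u v \<and> v \<in> line u v \<and> line u v \<subseteq> ground M"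
    and unique: "\<And>x y u v. x \<in> ground M \<Longrightarrow> y \<in> ground M \<Longrightarrow> x \<noteq> y \<Longrightarrow> u \<in> line x y \<Longrightarrow> v \<in> line x y \<Longrightarrow> u \<noteq> v \<Longrightarrow>
      line u v = line x y"
    and circ: "\<And>x y b u v. x \<in> ground M \<Longrightarrow> y \<in> ground M \<Longrightarrow> x \<noteq> y \<Longrightarrow> b \<in> line x y \<Longrightarrow> u \<in> line x y \<Longrightarrow>
      v \<in> line x y \<Longrightarrow> distinct [b, u, v] \<Longrightarrow> circuit M {b, u, v}"
    and dvd: "\<And>x y. x \<in> ground M \<Longrightarrow> y \<in> ground M \<Longrightarrow> x \<noteq> y \<Longrightarrow> int p dvd int (card (line x y))"
      "\<And>x y. x \<in> ground M \<Longrightarrow> y \<in> ground M \<Longrightarrow> x \<noteq> y \<Longrightarrow> int p dvd (\<Sum>v\<in>line x y. \<eta> v)"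
  shows "(\<Sum>u\<in>ground M. word [u]) * (\<Sum>v\<in>ground M. of_int (\<eta> v) * word [v]) \<in> os_mod_kernel p M"
proof -
  let ?V = "ground M"
  define h where "h = (\<lambda>(u, v). of_int (\<eta> v) * (word [u] * word [v]))"
  define off where "off L = {(u, v) \<in> L \<times> L. u \<noteq> v}" for L :: "'a set"
  have diag: "(\<Sum>z\<in>L \<times> L. h z) - (\<Sum>z\<in>off L. h z) \<in> os_mod_kernel p M" if L: "L \<subseteq> ?V" for L
  proof -
    have f: "finite (L \<times> L)" using finite_subset[OF L fin] by simp
    have "off L \<subseteq> L \<times> L" by (auto simp: off_def)
    then have "(\<Sum>z\<in>L \<times> L. h z) - (\<Sum>z\<in>off L. h z) = (\<Sum>z\<in>L \<times> L - off L. h z)"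
      using f by (simp add: sum_diff)
    also have "\<dots> \<in> os_mod_kernel p M"
    proof (rule kernel_sum)
      fix z assume "z \<in> L \<times> L - off L"
      then obtain u where "z = (u, u)" "u \<in> ?V" using L by (auto simp: off_def)
      then show "h z \<in> os_mod_kernel p M"
        using kernel_mult(2)[OF kernel_square[OF word_tensor_degree[of u]] tensor_algebra_of_int_closed] by (simp add: h_def)
    qed
    finally show ?thesis .
  qed
  have off: "(\<Sum>z\<in>off (line x y). h z) \<in> os_mod_kernel p M" if xy: "x \<in> ?V" "y \<in> ?V" "x \<noteq> y" for x y
  proof -
    have L: "line x y \<subseteq> ?V" using mem[OF xy] by blast
    have "(\<Sum>z\<in>line x y \<times> line x y. h z) \<in> os_mod_kernel p M"
      unfolding h_def
      by (rule kernel_line[OF L finite_subset[OF L fin] _ dvd(1)[OF xy] dvd(2)[OF xy]]) (rule circ[OF xy])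
    from kernel_diff[OF this diag[OF L]] show ?thesis by simp
  qed
  have "finite (off ?V)" by (rule finite_subset[of _ "?V \<times> ?V"]) (use fin in \<open>auto simp: off_def\<close>)
  then have "(\<Sum>z\<in>off ?V. h z)
     = (\<Sum>L\<in>(\<lambda>(u, v). line u v) ` off ?V. \<Sum>z\<in>{z \<in> off ?V. (\<lambda>(u, v). line u v) z = L}. h z)"
    by (intro sum.group[symmetric]) auto
  also have "\<dots> \<in> os_mod_kernel p M"
  proof (rule kernel_sum)
    fix L assume "L \<in> (\<lambda>(u, v). line u v) ` off ?V"
    then obtain x y where xy: "x \<in> ?V" "y \<in> ?V" "x \<noteq> y" "L = line x y" by (auto simp: off_def)
    \<comment> \<open>The pairs assigned to a line are all pairs of distinct points on it.\<close>
    have "{z \<in> off ?V. (\<lambda>(u, v). line u v) z = L} = off L"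
    proof (intro subset_antisym subsetI)
      fix z assume "z \<in> {z \<in> off ?V. (\<lambda>(u, v). line u v) z = L}"
      then obtain u v where "z = (u, v)" "u \<in> ?V" "v \<in> ?V" "u \<noteq> v" "line u v = L" by (auto simp: off_def)
      then show "z \<in> off L" using mem[of u v] by (auto simp: off_def)
    next
      fix z assume "z \<in> off L"
      then obtain u v where "z = (u, v)" "u \<in> L" "v \<in> L" "u \<noteq> v" by (auto simp: off_def)
      then show "z \<in> {z \<in> off ?V. (\<lambda>(u, v). line u v) z = L}"
        using unique[OF xy(1-3), of u v] mem[OF xy(1-3)] xy(4) by (auto simp: off_def)
    qed
    then show "(\<Sum>z\<in>{z \<in> off ?V. (\<lambda>(u, v). line u v) z = L}. h z) \<in> os_mod_kernel p M"
      using off[OF xy(1-3)] xy(4) by simp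
  qed
  finally have "(\<Sum>z\<in>?V \<times> ?V. h z) \<in> os_mod_kernel p M"
    using kernel_add[OF _ diag[OF order_refl]] by fastforce
  moreover have "(\<Sum>u\<in>?V. word [u]) * (\<Sum>v\<in>?V. of_int (\<eta> v) * word [v]) = (\<Sum>z\<in>?V \<times> ?V. h z)"
  proof -
    have "word [u] * (of_int n * word [v]) = of_int n * (word [u] * word [v])" for u v :: 'a and n
      by (metis mult.assoc mult_of_int_commute)
    then show ?thesis by (simp add: sum_product h_def sum.cartesian_product)
  qed
  ultimately show ?thesis by simp
qed

section \<open>Lines of the affine matroid and the explicit cocycles\<close>

lemma affine_line_exists:
  assumes "u \<in> carrier_vec m" "v \<in> carrier_vec m" "u \<noteq> (v :: 'k::field vec)"
  obtains L where "affine_line m L" "u \<in> L" "v \<in> L"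
  using collinear_pair[OF assms] that by (auto simp: collinear_in_def)

lemma circuit_collinear:
  fixes b u v :: "'k::{field,finite} vec"
  assumes L: "affine_line m L" "b \<in> L" "u \<in> L" "v \<in> L" and d: "distinct [b, u, v]"
  shows "circuit (affine_matroid m) {b, u, v}"
proof -
  let ?M = "affine_matroid m :: 'k vec matroid"
  have c: "{b, u, v} \<subseteq> carrier_vec m" using L affine_line_subset[OF L(1)] by blast
  have 3: "card {b, u, v} = 3" using d by auto
  moreover have "collinear_in m {b, u, v}" using L by (auto simp: collinear_in_def)
  moreover have "indep ?M X" if "X \<subset> {b, u, v}" for X
  proof -
    have "card X < 3" using psubset_card_mono[OF _ that] 3 by simp
    then show ?thesis using that c by (auto simp: indep_affine_matroid)
  qed
  ultimately show ?thesis using c by (simp add: circuit_def indep_affine_matroid)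
qed

lemma sum_affine_line:
  fixes a v :: "'k::{field,finite} vec"
  assumes "a \<in> carrier_vec m" "v \<in> carrier_vec m" "v \<noteq> 0\<^sub>v m"
  shows "(\<Sum>w\<in>{a + t \<cdot>\<^sub>v v | t. True}. \<eta> w) = (\<Sum>t\<in>UNIV. \<eta> (a + t \<cdot>\<^sub>v v))"
proof -
  obtain i where i: "i < m" "v $ i \<noteq> 0" using assms by (metis carrier_vecD eq_vecI index_zero_vec)
  have "s = t" if "a + s \<cdot>\<^sub>v v = a + t \<cdot>\<^sub>v v" for s t
  proof -
    have "(a + s \<cdot>\<^sub>v v) $ i = (a + t \<cdot>\<^sub>v v) $ i" using that by simp
    then show ?thesis using assms i by simp
  qed
  then have "inj (\<lambda>t. a + t \<cdot>\<^sub>v v)" by (rule injI)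
  then have "(\<Sum>w\<in>range (\<lambda>t. a + t \<cdot>\<^sub>v v). \<eta> w) = (\<Sum>t\<in>UNIV. \<eta> (a + t \<cdot>\<^sub>v v))"
    by (simp add: sum.reindex)
  then show ?thesis by (simp add: full_SetCompr_eq)
qed

lemma aomoto_betti_affine_matroid_ge:
  assumes prime: "prime p" and card: "CARD('k::{field,finite}) = p ^ s" "CARD('k) \<noteq> 2"
  shows "int m \<le> aomoto_betti p (affine_matroid m :: 'k vec matroid)"
proof -
  let ?M = "affine_matroid m :: 'k vec matroid"
  have "card {0, 1 :: 'k} \<le> CARD('k)" by (rule card_mono) auto
  then have card3: "CARD('k) > 2" using card(2) by simp
  have "s \<noteq> 0" using card3 card(1) by (intro notI) simp
  then have pdvd: "int p dvd int CARD('k)" unfolding card(1) by (simp add: dvd_power)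
  have "UNIV \<noteq> {0, 1 :: 'k}" using card3 by (metis card_2_iff less_irrefl zero_neq_one)
  then obtain z :: 'k where z: "z \<noteq> 0" "z \<noteq> 1" by blast
  \<comment> \<open>Two properties matter: the values sum to zero, and \<open>g\<close> vanishes at
    \<open>z\<close> while \<open>g 0 = 1\<close>, which separates the coordinates below.\<close>
  define g :: "'k \<Rightarrow> int" where "g t = (if t = 0 then 1 else if t = 1 then - 1 else 0)" for t
  have gsum: "(\<Sum>t\<in>UNIV. g t) = 0"
  proof -
    have "(\<Sum>t\<in>UNIV. g t) = (\<Sum>t\<in>{0, 1}. g t)"
      by (rule sum.mono_neutral_right) (auto simp: g_def)
    then show ?thesis by (simp add: g_def)
  qed
  \<comment> \<open>Index 0 is the constant function; index \<open>j > 0\<close> belongs to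
    coordinate \<open>j - 1\<close>.\<close>
  define \<eta> :: "nat \<Rightarrow> 'k vec \<Rightarrow> int" where "\<eta> j u = (if j = 0 then 1 else g (u $ (j - 1)))" for j u
  have line_dvd: "int p dvd (\<Sum>w\<in>L. \<eta> j w)" if "affine_line m L" "j \<le> m" for j L
  proof -
    obtain a v where av: "a \<in> carrier_vec m" "v \<in> carrier_vec m" "v \<noteq> 0\<^sub>v m" "L = {a + t \<cdot>\<^sub>v v | t. True}"
      using \<open>affine_line m L\<close> unfolding affine_line_def by blast
    have sum: "(\<Sum>w\<in>L. \<eta> j w) = (\<Sum>t\<in>UNIV. \<eta> j (a + t \<cdot>\<^sub>v v))"
      unfolding av(4) by (rule sum_affine_line[OF av(1-3)])
    show ?thesis
    proof (cases "j = 0")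
      case True
      then show ?thesis unfolding sum using pdvd by (simp add: \<eta>_def)
    next
      case False
      then have j: "j - 1 < m" using that by simp
      have e: "(\<Sum>w\<in>L. \<eta> j w) = (\<Sum>t\<in>UNIV. g (a $ (j - 1) + t * v $ (j - 1)))"
        unfolding sum using False j av by (simp add: \<eta>_def)
      show ?thesis
      \<comment> \<open>Along the line the coordinate is either constant, giving
        \<open>CARD('k)\<close> equal terms, or runs once through the field, giving the sum of
        \<open>g\<close>.\<close>
      proof (cases "v $ (j - 1) = 0")
        case True
        then show ?thesis unfolding e using pdvd by simp
      next
        case nz: False
        have "bij (\<lambda>t. a $ (j - 1) + t * v $ (j - 1))"
          by (rule bij_betw_byWitness[where f' = "\<lambda>s. (s - a $ (j - 1)) / v $ (j - 1)"]) (use nz in auto)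
        then have "(\<Sum>t\<in>UNIV. g (a $ (j - 1) + t * v $ (j - 1))) = (\<Sum>t\<in>UNIV. g t)"
          by (rule sum.reindex_bij_betw)
        then show ?thesis unfolding e using gsum by simp
      qed
    qed
  qed
  define line where "line u v = (SOME L. affine_line m L \<and> u \<in> L \<and> v \<in> L)" for u v :: "'k vec"
  have line: "affine_line m (line u v) \<and> u \<in> line u v \<and> v \<in> line u v"
    if "u \<in> carrier_vec m" "v \<in> carrier_vec m" "u \<noteq> v" for u v
    unfolding line_def by (rule someI_ex) (use affine_line_exists[OF that] in blast)
  have kernel: "(\<Sum>u\<in>ground ?M. word [u]) * (\<Sum>u\<in>ground ?M. of_int (\<eta> j u) * word [u]) \<in> os_mod_kernel p ?M"
    if "j \<le> m" for j
  proof (rule kernel_sigma_mult[where line = line])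
    show "finite (ground ?M)" by (simp add: finite_carrier_vec)
    show "u \<in> line u v \<and> v \<in> line u v \<and> line u v \<subseteq> ground ?M"
      if "u \<in> ground ?M" "v \<in> ground ?M" "u \<noteq> v" for u v
      using line[of u v] that affine_line_subset[of m "line u v"] by simp
    show "line u v = line x y"
      if "x \<in> ground ?M" "y \<in> ground ?M" "x \<noteq> y" "u \<in> line x y" "v \<in> line x y" "u \<noteq> v" for x y u v
    proof -
      have xy: "affine_line m (line x y)" using line that by simp
      then have "u \<in> carrier_vec m" "v \<in> carrier_vec m" using that affine_line_subset by blast+
      then show ?thesis using affine_line_unique[of m "line u v" "line x y" u v] line[of u v] xy that by simp
    qed
    show "circuit ?M {b, u, v}"
      if "x \<in> ground ?M" "y \<in> ground ?M" "x \<noteq> y" "b \<in> line x y" "u \<in> line x y" "v \<in> line x y" "distinct [b, u, v]"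
      for x y b u v
      by (rule circuit_collinear[OF _ that(4-7)]) (use line that in simp)
    show "int p dvd int (card (line x y))" if "x \<in> ground ?M" "y \<in> ground ?M" "x \<noteq> y" for x y
    proof -
      \<comment> \<open>\<open>\<eta> 0\<close> is constantly 1, so its sum counts the points of the
        line.\<close>
      have "int p dvd (\<Sum>w\<in>line x y. \<eta> 0 w)" by (rule line_dvd) (use line that in simp_all)
      then show ?thesis by (simp add: \<eta>_def)
    qed
    show "int p dvd (\<Sum>v\<in>line x y. \<eta> j v)" if "x \<in> ground ?M" "y \<in> ground ?M" "x \<noteq> y" for x y
      by (rule line_dvd) (use line that \<open>j \<le> m\<close> in simp_all)
  qed
  define \<tau> where "\<tau> j = (\<Sum>u\<in>ground ?M. of_int (\<eta> j u) * word [u])" for j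
  have lookup_\<tau>: "Poly_Mapping.lookup (\<tau> j) (Letters [w]) = \<eta> j w" if "w \<in> carrier_vec m" for j w
  proof -
    have "Poly_Mapping.lookup (\<tau> j) (Letters [w]) = (\<Sum>u\<in>carrier_vec m. if u = w then \<eta> j u else 0)"
      unfolding \<tau>_def lookup_sum lookup_mult_single
      by (intro sum.cong) (auto simp: lookup_of_int_Letters word_def lookup_single when_def)
    then show ?thesis using that by (simp add: finite_carrier_vec)
  qed
  \<comment> \<open>Together with the constant one there are \<open>m + 1\<close> cocycles, which
    offsets the 1 subtracted in \<open>aomoto_betti\<close>.\<close>
  have "int (Suc m) - 1 \<le> aomoto_betti p ?M"
  proof (rule aomoto_betti_ge[OF simple_affine_matroid prime, where t = \<tau>])
    show "finite (ground ?M)" by (simp add: finite_carrier_vec)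
    show "\<tau> j \<in> tensor_degree (ground ?M) 1" for j
      unfolding \<tau>_def by (intro tensor_degree_sum tensor_degree_of_int_mult word_tensor_degree)
    show "(\<Sum>u\<in>ground ?M. word [u]) * \<tau> j \<in> os_mod_kernel p ?M" if "j < Suc m" for j
      unfolding \<tau>_def using kernel that by simp
  next
    fix c :: "nat \<Rightarrow> int" and i
    assume c: "\<And>u. int p dvd (\<Sum>j<Suc m. c j * Poly_Mapping.lookup (\<tau> j) (Letters [u]))" and i: "i < Suc m"
    have c': "int p dvd c 0 + (\<Sum>j<m. c (Suc j) * g (u $ j))" if "u \<in> carrier_vec m" for u
      using c[of u] by (simp add: lookup_\<tau>[OF that] sum.lessThan_Suc_shift \<eta>_def del: sum.lessThan_Suc)
    \<comment> \<open>At the vector with all entries \<open>z\<close> every \<open>g\<close>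
      vanishes and only \<open>c 0\<close> remains.\<close>
    have 0: "int p dvd c 0" using c'[of "vec m (\<lambda>_. z)"] z by (simp add: g_def)
    show "int p dvd c i"
    proof (cases i)
      case 0
      then show ?thesis using \<open>int p dvd c 0\<close> by simp
    next
      case (Suc k)
      then have k: "k < m" using i by simp
      \<comment> \<open>Changing entry \<open>k\<close> from \<open>z\<close> to 0 switches on
        exactly the coefficient \<open>c (Suc k)\<close>.\<close>
      let ?u = "vec m (\<lambda>j. if j = k then 0 else z)"
      have "(\<Sum>j<m. c (Suc j) * g (?u $ j)) = (\<Sum>j<m. if j = k then c (Suc j) else 0)"
        by (intro sum.cong) (auto simp: g_def z)
      also have "\<dots> = c i" using k Suc by simp
      finally have "int p dvd c 0 + c i" using c'[of ?u] by simp
      then show ?thesis using 0 by (simp add: dvd_add_right_iff)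
    qed
  qed
  then show ?thesis by simp
qed

theorem proposition9p5:
  fixes p s :: nat
  assumes "prime p"
    and "CARD('k::{field,finite}) = p ^ s"
    and "CARD('k) \<noteq> 2"
  shows "(\<forall>m\<ge>1. int m \<le> aomoto_betti p (affine_matroid m :: 'k vec matroid)) \<and>
    (CARD('k) \<noteq> 3 \<longrightarrow>
      (\<forall>m\<ge>2. \<not> realizable_over_complex (affine_matroid m :: 'k vec matroid)))"
proof (intro conjI allI impI)
  fix m show "int m \<le> aomoto_betti p (affine_matroid m :: 'k vec matroid)"
    by (rule aomoto_betti_affine_matroid_ge[OF assms])
next
  fix m :: nat assume "CARD('k) \<noteq> 3" "m \<ge> 2"
  \<comment> \<open>A field has at least two elements, so excluding the sizes 2 and 3 leaves more
    than 3.\<close>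
  moreover have "card {0, 1 :: 'k} \<le> CARD('k)" by (rule card_mono) auto
  ultimately show "\<not> realizable_over_complex (affine_matroid m :: 'k vec matroid)"
    using assms(3) by (intro affine_matroid_not_realizable) simp_all
qed

end
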